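(* Let $n\ge 0$ and $m\ge 1$ be integers and let $a,b$ be complex parameters. With the generalized Umemura polynomials $U_{n,m}^{(k)}(z,w;a,b)$ defined in the context, write $U_{n,m}:=U_{n,m}^{(0)}(z,w;a,b)$ and $U^{(1)}_{n,m}:=U^{(1)}_{n,m}(z,w;a,b)$. Regard $z,w$ as functions of a variable $x$ via $$z=\tfrac12\left(e^x+e^{-x}-2\right)^{1/2},\qquad w=\tfrac12\left(e^x+e^{-x}+2\right)^{1/2},$$ so that all polynomials become functions of $x$. Then $$U_{n,m-1}U_{n,m+1}=\left(-\bar a_{n+2m+2}\,z^2+\bar b_{n+2m+2}\,w^2\right)U_{n,m}^2+8z^2w^2\,D_x^2\,U_{n,m}\circ U_{n,m}-\frac{4}{(n+2m+1)^2}\,ab(a-b)\,z^2w^2\left(U^{(1)}_{n,m}\right)^2,$$ where for functions $f,g$ of $x$, $D_x^2 f\circ g=f''g-2f'g'+fg''$ (second Hirota derivative, $'=d/dx$).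
   Context: For integers $n,m\ge 0$ let $[n;m]=\{1,2,\dots,n,\,n+2,n+4,\dots,n+2m\}$, and for an integer $k$ with $0\le k\le n$ let $[k]=\{1,\dots,k\}$ (so $[0]=\emptyset$). For a subset $I\subset[n;m]$ put $$\mathbf d_{n,m}(I)=\prod_{i\in I,\ j\in[n;m]\setminus I}\left|\frac{i+j}{i-j}\right|,\qquad \mathbf c(I)=\sum_{i\in I,\ i>n}\frac{i-n}{2},$$ and let $|I|=\sum_{i\in I} i$ denote the sum of the elements of $I$. For a complex parameter $a$ set $\bar a_j=a+(j-1)^2$ for $j\ge1$, and $a_{2j}=\bar a_2\bar a_4\cdots\bar a_{2j}$, $a_{2j+1}=\bar a_1\bar a_3\cdots\bar a_{2j+1}$; similarly $\bar b_j=b+(j-1)^2$, $b_{2j}=\bar b_2\bar b_4\cdots\bar b_{2j}$, $b_{2j+1}=\bar b_1\bar b_3\cdots\bar b_{2j+1}$. For a finite set $I$ of positive integers, $a_I=\prod_{i\in I}a_i$, $b_I=\prod_{i\in I}b_i$. Define $$e_I^{(n,m,k)}(z,w)=a_{I\setminus[k]}\,b_{[n;m]\setminus I}\,z^{|I\setminus[k]|}\,w^{|[n;m]\setminus I|}$$ and the generalized Umemura polynomial $$U_{n,m}^{(k)}(z,w;a,b)=\sum_{[k]\subset I\subset[n;m]}\ \prod_{i\in I\setminus[k],\ j\in[k]}\frac{i+j}{i-j}\ \mathbf d_{n,m}(I)\,(-1)^{\mathbf c(I)}\,e_I^{(n,m,k)}(z,w)$$ (a sum over subsets $I$ of $[n;m]$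 containing $[k]$; it is $0$ if $[k]\not\subset[n;m]$, e.g. $U^{(1)}_{0,m}=0$).
   Formalization: In the definition of U^(k) the factor (i+j)/(i-j) is replaced by (i+j)/(j-i); with the printed sign the identity fails, e.g. for n=m=1, a=1, b=2. Only odd k (here U^(1)) is affected; nothing changes for n=0 or ab(a-b)=0. *)

theory Defs
  imports "HOL-Complex_Analysis.Complex_Analysis"
begin

text \<open>The index set \<open>[n;m] = {1, \<dots>, n, n+2, n+4, \<dots>, n+2m}\<close>; the set \<open>[k]\<close> is \<open>{1..k}\<close>.\<close>

definition idx :: "nat \<Rightarrow> nat \<Rightarrow> nat set" where
  "idx n m = {1..n} \<union> (\<lambda>j. n + 2 * j) ` {1..m}"

definition d_coeff :: "nat \<Rightarrow> nat \<Rightarrow> nat set \<Rightarrow> real" where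
  "d_coeff n m I = (\<Prod>i\<in>I. \<Prod>j\<in>idx n m - I. \<bar>(real i + real j) / (real i - real j)\<bar>)"

text \<open>The division by 2 is exact for \<open>I \<subseteq> idx n m\<close>.\<close>

definition c_exp :: "nat \<Rightarrow> nat set \<Rightarrow> nat" where
  "c_exp n I = (\<Sum>i\<in>{i\<in>I. i > n}. (i - n) div 2)"

text \<open>\<open>bar a j\<close> is $\bar a_j$ (for \<open>j \<ge> 1\<close>) and \<open>par a j\<close> is $a_j$, the product of those
  $\bar a_i$ with \<open>1 \<le> i \<le> j\<close> for which \<open>i\<close> has the parity of \<open>j\<close>. The same functions
  applied to \<open>b\<close> give $\bar b_j$ and $b_j$.\<close>

definition bar :: "complex \<Rightarrow> nat \<Rightarrow> complex" where
  "bar a j = a + (of_nat j - 1)\<^sup>2"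

definition par :: "complex \<Rightarrow> nat \<Rightarrow> complex" where
  "par a j = (\<Prod>i\<in>{i\<in>{1..j}. even i \<longleftrightarrow> even j}. bar a i)"

definition e_term ::
  "nat \<Rightarrow> nat \<Rightarrow> nat \<Rightarrow> nat set \<Rightarrow> complex \<Rightarrow> complex \<Rightarrow> complex \<Rightarrow> complex \<Rightarrow> complex" where
  "e_term n m k I z w a b =
     (\<Prod>i\<in>I - {1..k}. par a i) * (\<Prod>i\<in>idx n m - I. par b i)
       * z ^ (\<Sum>i\<in>I - {1..k}. i) * w ^ (\<Sum>i\<in>idx n m - I. i)"

text \<open>
  The generalized Umemura polynomial $U^{(k)}_{n,m}(z,w;a,b)$. The sum is empty, hence 0,
  unless \<open>{1..k} \<subseteq> idx n m\<close>.

  Sign correction: the source prints the factor as \<open>(i + j) / (i - j)\<close>. With that sign the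
  bilinear identity for $U_{n,m-1} U_{n,m+1}$ fails already for \<open>n = m = 1\<close>: it requires
  $U^{(1)}_{1,1} = \pm 2 (b_3 w^3 + a_3 z^3)$, whereas the printed sign gives
  $2 (b_3 w^3 - a_3 z^3)$. The factor is therefore taken to be \<open>(i + j) / (j - i)\<close>,
  which multiplies the summand of \<open>I\<close> by $(-1)^k$ for each element of \<open>I - {1..k}\<close>;
  for even \<open>k\<close>, in particular for $U_{n,m} = U^{(0)}_{n,m}$, nothing changes.
\<close>

definition umemura ::
  "nat \<Rightarrow> nat \<Rightarrow> nat \<Rightarrow> complex \<Rightarrow> complex \<Rightarrow> complex \<Rightarrow> complex \<Rightarrow> complex" where
  "umemura k n m z w a b =
     (\<Sum>I\<in>{I. {1..k} \<subseteq> I \<and> I \<subseteq> idx n m}.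
        (\<Prod>i\<in>I - {1..k}. \<Prod>j\<in>{1..k}. (of_nat i + of_nat j) / (of_nat j - of_nat i))
          * of_real (d_coeff n m I) * (- 1) ^ c_exp n I * e_term n m k I z w a b)"

text \<open>Second Hirota derivative $D_x^2\, f \circ g$.\<close>

definition hirota_D2 :: "(complex \<Rightarrow> complex) \<Rightarrow> (complex \<Rightarrow> complex) \<Rightarrow> complex \<Rightarrow> complex" where
  "hirota_D2 f g x =
     (deriv ^^ 2) f x * g x - 2 * deriv f x * deriv g x + f x * (deriv ^^ 2) g x"

text \<open>\<open>r\<close> is a branch of $f^{1/2}$ on \<open>S\<close>. Allowing every holomorphic branch covers the
  principal one wherever it is holomorphic, as well as the entire branches
  $2\sinh(x/2)$ and $2\cosh(x/2)$ of the two square roots used below.\<close>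

definition sqrt_branch_on ::
  "complex set \<Rightarrow> (complex \<Rightarrow> complex) \<Rightarrow> (complex \<Rightarrow> complex) \<Rightarrow> bool" where
  "sqrt_branch_on S f r \<longleftrightarrow> r holomorphic_on S \<and> (\<forall>x\<in>S. (r x)\<^sup>2 = f x)"

end

theory Submission
  imports Defs
begin

text \<open>
  All terms of the identity are sums over pairs \<open>(I, J)\<close> of subsets of \<open>P = [n;m]\<close>. For subsets
  \<open>C\<close>, \<open>D\<close> of \<open>P\<close> and \<open>X = n + 2m + 1\<close>, the residues of $x (a + x^2) \varphi(x) / (x^2 - X^2)$ with
  $$\varphi(x) = \prod_{j\in D} \frac{x+1+j}{x+1-j} \prod_{k\in C} \frac{x-1-k}{x-1+k}$$
  add up to zero. The residue at infinity yields $a + X^2 + 2(|C|-|D|)^2 - 2(|C|+|D|)$, which is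
  what the Hirota derivative and the factor $\bar a_{n+2m+2}$ contribute. Take this for the
  complements of \<open>I\<close> and \<open>J\<close>, multiply by $z^2$, and subtract it from the same relation for
  \<open>I\<close> and \<open>J\<close> with \<open>b\<close> in place of \<open>a\<close>, multiplied by $w^2$. After summation over \<open>(I, J)\<close> the
  residues at $\pm X$ form $U_{n,m-1} U_{n,m+1}$, the residues at 0 form the square of
  $U^{(1)}_{n,m}$, and the residues at the other points $\pm(j-1)$ cancel: because
  $a_j = \bar a_j a_{j-2}$ and $b_j = \bar b_j b_{j-2}$, the \<open>a\<close>-residue of \<open>(I, J)\<close> equals the
  \<open>b\<close>-residue of the pair obtained by removing \<open>j - 2\<close> from \<open>I\<close> and adding \<open>j\<close> to \<open>J\<close>.
\<close>

section \<open>Partial fractions\<close>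

text \<open>\<open>r K k\<close> is the residue of the product at \<open>t k\<close>. The first
  moment is the coefficient of \<open>x^-2\<close> at infinity; in the product it is the sum of the
  \<open>c k * t k\<close> plus the second elementary symmetric function of the
  \<open>c k\<close>.\<close>

lemma partial_fractions:
  fixes c t :: "'a \<Rightarrow> complex"
  defines "r \<equiv> \<lambda>K k. c k * (\<Prod>l\<in>K - {k}. 1 + c l / (t k - t l))"
  assumes "finite K" "inj_on t K"
  shows partial_fractions_eval:
      "x \<notin> t ` K \<Longrightarrow> (\<Prod>k\<in>K. 1 + c k / (x - t k)) = 1 + (\<Sum>k\<in>K. r K k / (x - t k))"
    and partial_fractions_first_moment: "(\<Sum>k\<in>K. r K k * t k) =
      (\<Sum>k\<in>K. c k * t k) + ((\<Sum>k\<in>K. c k)\<^sup>2 - (\<Sum>k\<in>K. (c k)\<^sup>2)) / 2"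
proof -
  \<comment> \<open>The sum of the residues, the coefficient of \<open>1/x\<close> at infinity, is
    proved along because the induction step for the first moment uses it.\<close>
  have "(\<forall>x. x \<notin> t ` K \<longrightarrow> (\<Prod>k\<in>K. 1 + c k / (x - t k)) = 1 + (\<Sum>k\<in>K. r K k / (x - t k)))
    \<and> (\<Sum>k\<in>K. r K k) = (\<Sum>k\<in>K. c k) \<and> (\<Sum>k\<in>K. r K k * t k) =
      (\<Sum>k\<in>K. c k * t k) + ((\<Sum>k\<in>K. c k)\<^sup>2 - (\<Sum>k\<in>K. (c k)\<^sup>2)) / 2"
    using assms(2,3)
  proof (induction K)
    case empty
    then show ?case by simp
  next
    case (insert p K)
    define T where "T = t p"
    have inj: "inj_on t K" and T: "T \<notin> t ` K"
      using insert.prems insert.hyps by (auto simp: T_def)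
    note IH = insert.IH[OF inj]
    have ne: "t k - T \<noteq> 0" "T - t k \<noteq> 0" if "k \<in> K" for k using that T by auto
    have rp: "r (insert p K) p = c p * (1 + (\<Sum>k\<in>K. r K k / (T - t k)))"
    proof -
      have "r (insert p K) p = c p * (\<Prod>l\<in>K. 1 + c l / (T - t l))"
        using insert.hyps by (simp add: r_def T_def)
      then show ?thesis using IH T by auto
    qed
    have rk: "r (insert p K) k = r K k * (1 + c p / (t k - T))" if "k \<in> K" for k
    proof -
      have "insert p K - {k} = insert p (K - {k})" using that insert.hyps by auto
      then show ?thesis using insert.hyps by (simp add: r_def T_def mult_ac)
    qed
    \<comment> \<open>Inserting \<open>p\<close> changes a weighted sum of residues through the
      divided differences of the weight \<open>g\<close>. The weights \<open>1 / (x - t k)\<close>,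
      \<open>t k\<close> and 1 then yield the three claims.\<close>
    have sum_ins: "(\<Sum>k\<in>insert p K. r (insert p K) k * g k) =
        (\<Sum>k\<in>K. r K k * g k) + c p * g p
        + c p * (\<Sum>k\<in>K. r K k * ((g k - g p) / (t k - T)))" for g
    proof -
      have "(\<Sum>k\<in>insert p K. r (insert p K) k * g k)
          = c p * (1 + (\<Sum>k\<in>K. r K k / (T - t k))) * g p
            + (\<Sum>k\<in>K. r K k * (1 + c p / (t k - T)) * g k)"
        using insert.hyps rp rk by simp
      also have "(\<Sum>k\<in>K. r K k * (1 + c p / (t k - T)) * g k) =
          (\<Sum>k\<in>K. r K k * g k) + c p * (\<Sum>k\<in>K. r K k * (g k / (t k - T)))"
        by (simp add: sum_distrib_left sum.distrib[symmetric] algebra_simps)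
      also have "(\<Sum>k\<in>K. r K k / (T - t k)) = - (\<Sum>k\<in>K. r K k * (1 / (t k - T)))"
        unfolding sum_negf[symmetric] using ne by (intro sum.cong) (auto simp: field_simps)
      finally have "(\<Sum>k\<in>insert p K. r (insert p K) k * g k) = (\<Sum>k\<in>K. r K k * g k) + c p * g p
        + c p * ((\<Sum>k\<in>K. r K k * (g k / (t k - T))) - (\<Sum>k\<in>K. r K k * (1 / (t k - T))) * g p)"
        by (simp add: algebra_simps)
      also have "(\<Sum>k\<in>K. r K k * (g k / (t k - T))) - (\<Sum>k\<in>K. r K k * (1 / (t k - T))) * g p
          = (\<Sum>k\<in>K. r K k * ((g k - g p) / (t k - T)))"
        unfolding sum_distrib_right sum_subtractf[symmetric]
        by (intro sum.cong) (auto simp: diff_divide_distrib algebra_simps)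
      finally show ?thesis .
    qed
    have 1: "(\<Prod>k\<in>insert p K. 1 + c k / (x - t k)) =
        1 + (\<Sum>k\<in>insert p K. r (insert p K) k / (x - t k))" if "x \<notin> t ` insert p K" for x
    proof -
      have x: "x - T \<noteq> 0" "x - t k \<noteq> 0" if "k \<in> K" for k
        using \<open>x \<notin> t ` insert p K\<close> that by (auto simp: T_def)
      have e: "(1 / (x - t k) - 1 / (x - T)) / (t k - T) = 1 / (x - t k) / (x - T)" if "k \<in> K" for k
        using x[OF that] ne[OF that] by (simp add: divide_simps)
      have "(\<Sum>k\<in>insert p K. r (insert p K) k * (1 / (x - t k))) =
        (\<Sum>k\<in>K. r K k * (1 / (x - t k))) + c p * (1 / (x - T))
        + c p * (\<Sum>k\<in>K. r K k * (1 / (x - t k) / (x - T)))"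
        unfolding sum_ins[of "\<lambda>k. 1 / (x - t k)"] T_def[symmetric] using e by simp
      also have "(\<Sum>k\<in>K. r K k * (1 / (x - t k) / (x - T))) = (\<Sum>k\<in>K. r K k * (1 / (x - t k))) / (x - T)"
        by (simp add: sum_divide_distrib)
      finally show ?thesis
        using insert.hyps IH that by (simp add: T_def algebra_simps add_divide_distrib)
    qed
    have "(\<Sum>k\<in>K. r K k * ((t k - T) / (t k - T))) = (\<Sum>k\<in>K. c k)"
      using ne IH by simp
    then have "(\<Sum>k\<in>insert p K. r (insert p K) k * t k) =
        (\<Sum>k\<in>insert p K. c k * t k)
        + ((\<Sum>k\<in>insert p K. c k)\<^sup>2 - (\<Sum>k\<in>insert p K. (c k)\<^sup>2)) / 2"
      unfolding sum_ins[of t] using IH insert.hyps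
      by (simp add: T_def power2_eq_square field_simps)
    moreover have "(\<Sum>k\<in>insert p K. r (insert p K) k) = (\<Sum>k\<in>insert p K. c k)"
      using sum_ins[of "\<lambda>_. 1"] IH insert.hyps by simp
    ultimately show ?case using 1 by blast
  qed
  then show "x \<notin> t ` K \<Longrightarrow> (\<Prod>k\<in>K. 1 + c k / (x - t k)) = 1 + (\<Sum>k\<in>K. r K k / (x - t k))"
    and "(\<Sum>k\<in>K. r K k * t k) =
      (\<Sum>k\<in>K. c k * t k) + ((\<Sum>k\<in>K. c k)\<^sup>2 - (\<Sum>k\<in>K. (c k)\<^sup>2)) / 2"
    by auto
qed

section \<open>The rational function \<phi> of a pair of sets and its residues\<close>

definition up :: "nat set \<Rightarrow> complex \<Rightarrow> complex" where
  "up C x = (\<Prod>k\<in>C. (x + of_nat k) / (x - of_nat k))"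

text \<open>\<open>res C D j\<close> is the residue at \<open>x = j - 1\<close> of $\varphi(x) =$ \<open>up D (1 + x) * up C (1 - x)\<close>.
  Since $\varphi(-x)$ arises from $\varphi(x)$ by exchanging \<open>C\<close> and \<open>D\<close>, the residue at \<open>x = 1 - k\<close>
  is \<open>- res D C k\<close>.\<close>

definition res :: "nat set \<Rightarrow> nat set \<Rightarrow> nat \<Rightarrow> complex" where
  "res C D j = 2 * of_nat j * up (D - {j}) (of_nat j) * up C (2 - of_nat j)"

definition wsum :: "nat set \<Rightarrow> complex" where
  "wsum C = (\<Sum>k\<in>C. of_nat k)"

text \<open>If \<open>f j = g (j - 1)\<close> with \<open>g\<close> odd, and if the poles of \<phi>
  are distinct and \<open>g\<close> is regular there, this is the sum of the residues of \<phi>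
  times \<open>g\<close> at these poles: the minus sign of the residue at \<open>1 - k\<close> is
  absorbed by \<open>g\<close>.\<close>

definition res_sum :: "nat set \<Rightarrow> nat set \<Rightarrow> (nat \<Rightarrow> complex) \<Rightarrow> complex" where
  "res_sum C D f = (\<Sum>j\<in>D. res C D j * f j) + (\<Sum>k\<in>C. res D C k * f k)"

lemma res_sum_add: "res_sum C D (\<lambda>j. f j + g j) = res_sum C D f + res_sum C D g"
  by (simp add: res_sum_def sum.distrib algebra_simps)

lemma res_sum_mult: "res_sum C D (\<lambda>j. c * f j) = c * res_sum C D f"
  by (simp add: res_sum_def sum_distrib_left algebra_simps)

lemma res_sum_cong:
  "(\<And>j. j \<in> C \<union> D \<Longrightarrow> f j = g j) \<Longrightarrow> res_sum C D f = res_sum C D g"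
  by (simp add: res_sum_def)

lemma sum_of_nat_eq_2:
  assumes "(of_nat j :: complex) - 1 = 1 - of_nat k" "j > 0" "k > 0"
  shows "j = 1 \<and> k = 1"
proof -
  have "(of_nat (j + k) :: complex) = of_nat 2" using assms(1) by (simp add: algebra_simps)
  then have "j + k = 2" using of_nat_eq_iff by blast
  with assms show ?thesis by auto
qed

text \<open>\<open>partial_fractions\<close> applies because
  \<open>(x + 1 + j) / (x + 1 - j)\<close> is \<open>1 + 2 * j / (x - (j - 1))\<close> and
  \<open>(x - 1 - k) / (x - 1 + k)\<close> is \<open>1 - 2 * k / (x - (1 - k))\<close>. For positive
  \<open>j\<close>, \<open>k\<close> the poles \<open>j - 1\<close> and \<open>1 - k\<close>
  coincide only if both indices are 1, which \<open>one\<close> excludes.\<close>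

lemma
  assumes fin: "finite C" "finite D" and pos: "0 \<notin> C" "0 \<notin> D" and one: "\<not> (1 \<in> C \<and> 1 \<in> D)"
  shows up_partial_fractions:
      "(\<And>j. j \<in> D \<Longrightarrow> x \<noteq> of_nat j - 1) \<Longrightarrow> (\<And>k. k \<in> C \<Longrightarrow> x \<noteq> 1 - of_nat k) \<Longrightarrow>
       up D (1 + x) * up C (1 - x) = 1 + (\<Sum>j\<in>D. res C D j / (x - (of_nat j - 1)))
         - (\<Sum>k\<in>C. res D C k / (x - (1 - of_nat k)))"
    and res_sum_first_moment:
      "res_sum C D (\<lambda>j. of_nat j - 1) = 2 * (wsum C - wsum D)\<^sup>2 - 2 * (wsum C + wsum D)"
proof -
  \<comment> \<open>A disjoint sum, because an index in both sets contributes two poles, at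
    \<open>j - 1\<close> and at \<open>1 - j\<close>.\<close>
  define K where "K = D <+> C"
  define t :: "nat + nat \<Rightarrow> complex" where "t = case_sum (\<lambda>j. of_nat j - 1) (\<lambda>k. 1 - of_nat k)"
  define c :: "nat + nat \<Rightarrow> complex" where "c = case_sum (\<lambda>j. 2 * of_nat j) (\<lambda>k. - 2 * of_nat k)"
  define r where "r = (\<lambda>k. c k * (\<Prod>l\<in>K - {k}. 1 + c l / (t k - t l)))"
  have K: "finite K" using fin by (simp add: K_def)
  have p: "j > 0" if "j \<in> C \<union> D" for j using that pos by (metis Un_iff gr0I)
  have "False" if "of_nat j - (1::complex) = 1 - of_nat k" "j \<in> D" "k \<in> C" for j k
    using sum_of_nat_eq_2[OF that(1)] p that(2,3) one by auto
  then have inj: "inj_on t K"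
    unfolding K_def t_def inj_on_def by (fastforce elim!: PlusE)
  have prod_Plus: "prod g (A <+> B) = (\<Prod>j\<in>A. g (Inl j)) * (\<Prod>k\<in>B. g (Inr k))"
    if "finite A" "finite B" for A B and g :: "nat + nat \<Rightarrow> complex"
    using prod.Plus[OF that, of g] by (simp add: o_def)
  have sum_Plus: "sum g K = (\<Sum>j\<in>D. g (Inl j)) + (\<Sum>k\<in>C. g (Inr k))"
    for g :: "nat + nat \<Rightarrow> complex"
    using sum.Plus[OF fin(2,1), of g] by (simp add: o_def K_def)
  have frac: "1 + u / v = (v + u) / v" if "v \<noteq> 0" for u v :: complex
    using that by (simp add: field_simps)
  have ne: "of_nat j - 1 \<noteq> (1::complex) - of_nat k" if "j \<in> D" "k \<in> C" for j k
    using sum_of_nat_eq_2[of j k] p that one by auto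
  have r1: "r (Inl j) = res C D j" if "j \<in> D" for j
  proof -
    have "K - {Inl j} = (D - {j}) <+> C" unfolding K_def by auto
    then have "r (Inl j) = 2 * of_nat j * ((\<Prod>l\<in>D - {j}. 1 + 2 * of_nat l / (of_nat j - of_nat l))
        * (\<Prod>k\<in>C. 1 - 2 * of_nat k / (of_nat j - 1 - (1 - of_nat k))))"
      unfolding r_def using fin by (simp add: prod_Plus c_def t_def)
    also have "(\<Prod>l\<in>D - {j}. 1 + 2 * of_nat l / (of_nat j - of_nat l)) = up (D - {j}) (of_nat j)"
      unfolding up_def by (intro prod.cong refl, subst frac) auto
    also have "(\<Prod>k\<in>C. 1 - 2 * of_nat k / (of_nat j - 1 - (1 - of_nat k))) = up C (2 - of_nat j)"
      unfolding up_def
    proof (intro prod.cong refl)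
      fix k assume "k \<in> C"
      then have "of_nat j + of_nat k - 2 \<noteq> (0::complex)" using ne[OF that, of k] by (auto simp: algebra_simps)
      moreover from this have "2 - of_nat j - of_nat k \<noteq> (0::complex)" by (auto simp: algebra_simps)
      ultimately show "1 - 2 * of_nat k / (of_nat j - 1 - (1 - of_nat k)) =
          (2 - of_nat j + of_nat k :: complex) / (2 - of_nat j - of_nat k)"
        by (simp add: divide_simps) (simp add: algebra_simps)
    qed
    finally show ?thesis by (simp add: res_def)
  qed
  have r2: "r (Inr k) = - res D C k" if "k \<in> C" for k
  proof -
    have "K - {Inr k} = D <+> (C - {k})" unfolding K_def by auto
    then have "r (Inr k) = - 2 * of_nat k * ((\<Prod>l\<in>D. 1 + 2 * of_nat l / (1 - of_nat k - (of_nat l - 1)))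
        * (\<Prod>l\<in>C - {k}. 1 - 2 * of_nat l / (of_nat l - of_nat k)))"
      unfolding r_def using fin by (simp add: prod_Plus c_def t_def)
    also have "(\<Prod>l\<in>C - {k}. 1 - 2 * of_nat l / (of_nat l - of_nat k)) = up (C - {k}) (of_nat k)"
      unfolding up_def
    proof (intro prod.cong refl)
      fix l assume "l \<in> C - {k}"
      then have "of_nat l - of_nat k \<noteq> (0::complex)" "of_nat k - of_nat l \<noteq> (0::complex)" by auto
      then show "1 - 2 * of_nat l / (of_nat l - of_nat k) =
          (of_nat k + of_nat l :: complex) / (of_nat k - of_nat l)"
        by (simp add: divide_simps) (simp add: algebra_simps)
    qed
    also have "(\<Prod>l\<in>D. 1 + 2 * of_nat l / (1 - of_nat k - (of_nat l - 1))) = up D (2 - of_nat k)"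
      unfolding up_def
    proof (intro prod.cong refl)
      fix l assume "l \<in> D"
      then have "2 - of_nat k - of_nat l \<noteq> (0::complex)" using ne[OF _ that, of l] by (auto simp: algebra_simps)
      then have "1 + 2 * of_nat l / (2 - of_nat k - of_nat l) =
          (2 - of_nat k - of_nat l + 2 * of_nat l :: complex) / (2 - of_nat k - of_nat l)"
        by (rule frac)
      moreover have "1 - of_nat k - (of_nat l - 1) = (2 - of_nat k - of_nat l :: complex)"
        "2 - of_nat k - of_nat l + 2 * of_nat l = (2 - of_nat k + of_nat l :: complex)" by simp_all
      ultimately show "1 + 2 * of_nat l / (1 - of_nat k - (of_nat l - 1)) =
          (2 - of_nat k + of_nat l :: complex) / (2 - of_nat k - of_nat l)"
        by metis
    qed
    finally show ?thesis by (simp add: res_def)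
  qed
  show "up D (1 + x) * up C (1 - x) = 1 + (\<Sum>j\<in>D. res C D j / (x - (of_nat j - 1)))
         - (\<Sum>k\<in>C. res D C k / (x - (1 - of_nat k)))"
    if x: "\<And>j. j \<in> D \<Longrightarrow> x \<noteq> of_nat j - 1" "\<And>k. k \<in> C \<Longrightarrow> x \<noteq> 1 - of_nat k"
  proof -
    have "t ` K = (\<lambda>j. of_nat j - 1) ` D \<union> (\<lambda>k. 1 - of_nat k) ` C"
      by (simp add: K_def t_def Plus_def image_Un image_image)
    then have "x \<notin> t ` K" using x by blast
    from partial_fractions_eval[OF K inj this, of c]
    have "(\<Prod>k\<in>K. 1 + c k / (x - t k)) = 1 + (\<Sum>k\<in>K. r k / (x - t k))"
      by (simp add: r_def)
    also have "(\<Sum>k\<in>K. r k / (x - t k)) = (\<Sum>j\<in>D. res C D j / (x - (of_nat j - 1)))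
         - (\<Sum>k\<in>C. res D C k / (x - (1 - of_nat k)))"
      unfolding sum_Plus using r1 r2 by (simp add: t_def sum_negf)
    also have "(\<Prod>k\<in>K. 1 + c k / (x - t k)) = up D (1 + x) * up C (1 - x)"
    proof -
      have "(\<Prod>j\<in>D. 1 + 2 * of_nat j / (x - (of_nat j - 1))) = up D (1 + x)"
        unfolding up_def
      proof (intro prod.cong refl)
        fix j assume "j \<in> D"
        then have "1 + x - of_nat j \<noteq> 0" using x(1)[of j] by (auto simp: algebra_simps)
        then have "1 + 2 * of_nat j / (1 + x - of_nat j) = (1 + x - of_nat j + 2 * of_nat j) / (1 + x - of_nat j)"
          by (rule frac)
        moreover have "x - (of_nat j - 1) = 1 + x - of_nat j"
          "1 + x - of_nat j + 2 * of_nat j = 1 + x + of_nat j" by simp_all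
        ultimately show "1 + 2 * of_nat j / (x - (of_nat j - 1)) = (1 + x + of_nat j) / (1 + x - of_nat j)"
          by metis
      qed
      moreover have "(\<Prod>k\<in>C. 1 - 2 * of_nat k / (x - (1 - of_nat k))) = up C (1 - x)"
        unfolding up_def
      proof (intro prod.cong refl)
        fix k assume "k \<in> C"
        then have "x + of_nat k - 1 \<noteq> 0" using x(2)[of k] by (auto simp: algebra_simps)
        moreover from this have "1 - x - of_nat k \<noteq> 0" by (auto simp: algebra_simps)
        moreover have "x - (1 - of_nat k) = x + of_nat k - 1" by simp
        ultimately show "1 - 2 * of_nat k / (x - (1 - of_nat k)) = (1 - x + of_nat k) / (1 - x - of_nat k)"
          by (simp add: divide_simps) (simp add: algebra_simps)
      qed
      ultimately show ?thesis unfolding K_def using fin by (simp add: prod_Plus c_def t_def)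
    qed
    finally show ?thesis by simp
  qed
  have "res_sum C D (\<lambda>j. of_nat j - 1) = (\<Sum>k\<in>K. r k * t k)"
  proof -
    have "(\<Sum>k\<in>C. res D C k * (of_nat k - 1)) = (\<Sum>k\<in>C. r (Inr k) * (1 - of_nat k))"
      by (intro sum.cong) (auto simp: r2 algebra_simps)
    then show ?thesis unfolding sum_Plus res_sum_def by (simp add: t_def r1)
  qed
  also have "\<dots> = (\<Sum>k\<in>K. c k * t k) + ((\<Sum>k\<in>K. c k)\<^sup>2 - (\<Sum>k\<in>K. (c k)\<^sup>2)) / 2"
    using partial_fractions_first_moment[OF K inj, of c] by (simp add: r_def)
  also have "\<dots> = 2 * (wsum C - wsum D)\<^sup>2 - 2 * (wsum C + wsum D)"
  proof -
    have c1: "(\<Sum>k\<in>K. c k) = 2 * (wsum D - wsum C)"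
      unfolding sum_Plus
      by (simp add: c_def wsum_def sum_distrib_left[symmetric] sum_negf right_diff_distrib)
    \<comment> \<open>The quadratic terms cancel:
      \<open>2 * j * (j - 1) - 2 * j^2 = - 2 * j\<close>, and likewise on \<open>C\<close>.\<close>
    have c2: "(\<Sum>k\<in>K. c k * t k) - (\<Sum>k\<in>K. (c k)\<^sup>2) / 2 = - 2 * (wsum C + wsum D)"
    proof -
      have "(\<Sum>k\<in>K. c k * t k) - (\<Sum>k\<in>K. (c k)\<^sup>2) / 2 = (\<Sum>k\<in>K. c k * t k - (c k)\<^sup>2 / 2)"
        by (simp add: sum_subtractf sum_divide_distrib)
      also have "\<dots> = (\<Sum>j\<in>D. - 2 * of_nat j) + (\<Sum>j\<in>C. - 2 * of_nat j)"
        unfolding sum_Plus by (intro arg_cong2[where f = "(+)"] sum.cong)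
          (auto simp: c_def t_def power2_eq_square algebra_simps)
      finally show ?thesis
        by (simp add: wsum_def sum_distrib_left[symmetric] sum_negf distrib_left)
    qed
    have "(\<Sum>k\<in>K. c k * t k) + ((\<Sum>k\<in>K. c k)\<^sup>2 - (\<Sum>k\<in>K. (c k)\<^sup>2)) / 2 =
        (\<Sum>k\<in>K. c k * t k) - (\<Sum>k\<in>K. (c k)\<^sup>2) / 2 + (\<Sum>k\<in>K. c k)\<^sup>2 / 2"
      by (simp add: diff_divide_distrib)
    also have "\<dots> = 2 * (wsum C - wsum D)\<^sup>2 - 2 * (wsum C + wsum D)"
      unfolding c1 c2 by (simp add: power2_eq_square field_simps)
    finally show ?thesis .
  qed
  finally show "res_sum C D (\<lambda>j. of_nat j - 1) = 2 * (wsum C - wsum D)\<^sup>2 - 2 * (wsum C + wsum D)" .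
qed

text \<open>The left side is \<phi>(X) + \<phi>(-X). In the partial fractions a pole
  \<open>v\<close> with residue \<open>u\<close> contributes
  \<open>u / (X - v) - u / (X + v) = 2 * u * v / (X^2 - v^2)\<close>.\<close>

lemma up_sym_sum:
  assumes fin: "finite C" "finite D" and pos: "0 \<notin> C" "0 \<notin> D" and one: "\<not> (1 \<in> C \<and> 1 \<in> D)"
    and X: "\<And>j. j \<in> C \<union> D \<Longrightarrow> X\<^sup>2 \<noteq> (of_nat j - 1)\<^sup>2"
  shows "up D (1 + X) * up C (1 - X) + up C (1 + X) * up D (1 - X) =
    2 + 2 * res_sum C D (\<lambda>j. (of_nat j - 1) / (X\<^sup>2 - (of_nat j - 1)\<^sup>2))"
proof -
  have X': "X \<noteq> of_nat j - 1" "X \<noteq> 1 - of_nat j" if "j \<in> C \<union> D" for j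
    using X[OF that] by (auto simp: power2_commute)
  have e: "u / (X - v) - u / (X - (- v)) = 2 * (u * (v / (X\<^sup>2 - v\<^sup>2)))" if "X\<^sup>2 \<noteq> v\<^sup>2" for u v
  proof -
    have "X - v \<noteq> 0" "X + v \<noteq> 0" "X\<^sup>2 - v\<^sup>2 \<noteq> 0"
      using that by (auto simp: eq_neg_iff_add_eq_0[symmetric])
    moreover have "X\<^sup>2 - v\<^sup>2 = (X - v) * (X + v)" by (simp add: power2_eq_square algebra_simps)
    ultimately show ?thesis by (simp add: divide_simps) (simp add: algebra_simps)
  qed
  have "up D (1 + X) * up C (1 - X) + up C (1 + X) * up D (1 - X) = 2 +
     ((\<Sum>j\<in>D. res C D j / (X - (of_nat j - 1))) - (\<Sum>k\<in>C. res D C k / (X - (1 - of_nat k)))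
    + (\<Sum>j\<in>C. res D C j / (X - (of_nat j - 1))) - (\<Sum>k\<in>D. res C D k / (X - (1 - of_nat k))))"
  proof -
    have "\<not> (1 \<in> D \<and> 1 \<in> C)" using one by blast
    then have "up C (1 + X) * up D (1 - X) = 1 + (\<Sum>j\<in>C. res D C j / (X - (of_nat j - 1)))
         - (\<Sum>k\<in>D. res C D k / (X - (1 - of_nat k)))"
      by (rule up_partial_fractions[OF fin(2,1) pos(2,1)]) (use X' in auto)
    moreover have "up D (1 + X) * up C (1 - X) = 1 + (\<Sum>j\<in>D. res C D j / (X - (of_nat j - 1)))
         - (\<Sum>k\<in>C. res D C k / (X - (1 - of_nat k)))"
      by (rule up_partial_fractions[OF fin pos one]) (use X' in auto)
    ultimately show ?thesis by simp
  qed
  also have "(\<Sum>j\<in>D. res C D j / (X - (of_nat j - 1))) - (\<Sum>k\<in>C. res D C k / (X - (1 - of_nat k)))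
    + (\<Sum>j\<in>C. res D C j / (X - (of_nat j - 1))) - (\<Sum>k\<in>D. res C D k / (X - (1 - of_nat k))) =
    (\<Sum>j\<in>D. res C D j / (X - (of_nat j - 1)) - res C D j / (X - (- (of_nat j - 1))))
    + (\<Sum>j\<in>C. res D C j / (X - (of_nat j - 1)) - res D C j / (X - (- (of_nat j - 1))))"
    by (simp add: sum_subtractf)
  also have "\<dots> = 2 * res_sum C D (\<lambda>j. (of_nat j - 1) / (X\<^sup>2 - (of_nat j - 1)\<^sup>2))"
    unfolding res_sum_def distrib_left sum_distrib_left
    by (intro arg_cong2[where f = "(+)"] sum.cong refl e X) auto
  finally show ?thesis .
qed

lemma up_insert: "finite C \<Longrightarrow> k \<notin> C \<Longrightarrow> up (insert k C) x = (x + of_nat k) / (x - of_nat k) * up C x"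
  by (simp add: up_def)

text \<open>This is the vanishing of the sum of all residues of
  $x\,(a + x^2)\,\varphi(x) / (x^2 - X^2)$. If 1 lies in both sets, the poles \<open>j - 1\<close> and \<open>1 - k\<close>
  collide at 0, which is where the last summand comes from.\<close>

lemma pair_identity:
  fixes a X :: complex
  assumes fin: "finite C" "finite D" and pos: "0 \<notin> C" "0 \<notin> D"
    and X: "\<And>j. j \<in> C \<union> D \<Longrightarrow> X\<^sup>2 \<noteq> (of_nat j - 1)\<^sup>2" and X0: "X \<noteq> 0"
  shows "a + X\<^sup>2 + 2 * (wsum C - wsum D)\<^sup>2 - 2 * (wsum C + wsum D) =
    (a + X\<^sup>2) * (up D (1 + X) * up C (1 - X) + up C (1 + X) * up D (1 - X)) / 2
    + res_sum C D (\<lambda>j. (of_nat j - 1) * (a + (of_nat j - 1)\<^sup>2) / ((of_nat j - 1)\<^sup>2 - X\<^sup>2))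
    + (if 1 \<in> C \<and> 1 \<in> D then 4 * a / X\<^sup>2 * up (C - {1}) 1 * up (D - {1}) 1 else 0)"
proof (cases "1 \<in> C \<and> 1 \<in> D")
  case False
  have sym: "up D (1 + X) * up C (1 - X) + up C (1 + X) * up D (1 - X) =
    2 + 2 * res_sum C D (\<lambda>j. (of_nat j - 1) / (X\<^sup>2 - (of_nat j - 1)\<^sup>2))"
    by (rule up_sym_sum[OF fin pos False X])
  have "(a + X\<^sup>2) * (up D (1 + X) * up C (1 - X) + up C (1 + X) * up D (1 - X)) / 2
    + res_sum C D (\<lambda>j. (of_nat j - 1) * (a + (of_nat j - 1)\<^sup>2) / ((of_nat j - 1)\<^sup>2 - X\<^sup>2))
    = a + X\<^sup>2 + res_sum C D (\<lambda>j. (a + X\<^sup>2) * ((of_nat j - 1) / (X\<^sup>2 - (of_nat j - 1)\<^sup>2))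
      + (of_nat j - 1) * (a + (of_nat j - 1)\<^sup>2) / ((of_nat j - 1)\<^sup>2 - X\<^sup>2))"
    unfolding sym res_sum_add res_sum_mult by (simp add: algebra_simps)
  \<comment> \<open>With \<open>v = j - 1\<close>, the difference
    \<open>(a + X^2) * v - v * (a + v^2)\<close> is \<open>v * (X^2 - v^2)\<close>; the denominators
    cancel and the first moment remains.\<close>
  also have "\<dots> = a + X\<^sup>2 + res_sum C D (\<lambda>j. of_nat j - 1)"
  proof (intro arg_cong[where f = "\<lambda>u. a + X\<^sup>2 + u"] res_sum_cong)
    fix j assume "j \<in> C \<union> D"
    moreover define v where "v = of_nat j - (1::complex)"
    ultimately have "X\<^sup>2 - v\<^sup>2 \<noteq> 0" "v\<^sup>2 - X\<^sup>2 \<noteq> 0" using X[of j] by auto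
    then have "(a + X\<^sup>2) * (v / (X\<^sup>2 - v\<^sup>2)) + v * (a + v\<^sup>2) / (v\<^sup>2 - X\<^sup>2) = v"
      by (simp add: divide_simps) (simp add: algebra_simps)
    then show "(a + X\<^sup>2) * ((of_nat j - 1) / (X\<^sup>2 - (of_nat j - 1)\<^sup>2))
      + (of_nat j - 1) * (a + (of_nat j - 1)\<^sup>2) / ((of_nat j - 1)\<^sup>2 - X\<^sup>2) = of_nat j - 1"
      unfolding v_def .
  qed
  finally show ?thesis using False by (auto simp: res_sum_first_moment[OF fin pos False])
next
  case True
  \<comment> \<open>The factors of the common element 1 multiply to
    \<open>(x + 2) / x * ((2 - x) / (- x)) = 1 - 4 / x^2\<close>. The function of the reduced sets
    is regular at 0 and has an expansion in simple poles.\<close>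
  define C0 D0 where "C0 = C - {1}" and "D0 = D - {1}"
  have CD: "C = insert 1 C0" "D = insert 1 D0" "1 \<notin> C0" "1 \<notin> D0"
    using True by (auto simp: C0_def D0_def)
  have fin0: "finite C0" "finite D0" and pos0: "0 \<notin> C0" "0 \<notin> D0" and one0: "\<not> (1 \<in> C0 \<and> 1 \<in> D0)"
    using fin pos by (auto simp: C0_def D0_def)
  have X1: "X\<^sup>2 \<noteq> (of_nat j - 1)\<^sup>2" if "j \<in> C0 \<union> D0" for j using X that by (auto simp: CD)
  define h where "h = (\<lambda>j. (of_nat j - 1) * (a + (of_nat j - 1)\<^sup>2) / ((of_nat j - 1)\<^sup>2 - X\<^sup>2))"
  have res0: "res C D j = res C0 D0 j * (1 - 4 / (of_nat j - 1)\<^sup>2)"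
    if "j \<in> D0" "D = insert 1 D0" "C = insert 1 C0" "1 \<notin> D0" "finite D0" "1 \<notin> C0" "finite C0"
    for j C D C0 D0
  proof -
    have j: "j \<noteq> 1" using that by auto
    then have "of_nat j \<noteq> (1::complex)" by (metis of_nat_1 of_nat_eq_iff)
    then have n: "of_nat j - 1 \<noteq> (0::complex)" "1 - of_nat j \<noteq> (0::complex)" by auto
    have "D - {j} = insert 1 (D0 - {j})" using j that by auto
    then have "res C D j = res C0 D0 j * ((of_nat j + 1) / (of_nat j - 1) * ((3 - of_nat j) / (1 - of_nat j)))"
      using that by (simp add: res_def up_insert)
    also have "(of_nat j + 1) / (of_nat j - 1) * ((3 - of_nat j) / (1 - of_nat j)) = 1 - 4 / (of_nat j - (1::complex))\<^sup>2"
      using n by (simp add: divide_simps power2_eq_square) (simp add: algebra_simps)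
    finally show ?thesis .
  qed
  \<comment> \<open>Removes the index 1 from the residue sums: \<open>up C 1\<close> contains a
    division by 0, so \<open>res C D 1\<close> is not a residue.\<close>
  have h1: "h (Suc 0) = 0" by (simp add: h_def)
  have rs: "res_sum C D h = res_sum C0 D0 (\<lambda>j. (1 - 4 / (of_nat j - 1)\<^sup>2) * h j)"
  proof -
    have "(\<Sum>j\<in>D. res C D j * h j) = (\<Sum>j\<in>D0. res C0 D0 j * ((1 - 4 / (of_nat j - 1)\<^sup>2) * h j))"
      using res0[of _ D0 D C C0] fin0 CD by (simp add: h1 mult.assoc)
    moreover have "(\<Sum>j\<in>C. res D C j * h j) = (\<Sum>j\<in>C0. res D0 C0 j * ((1 - 4 / (of_nat j - 1)\<^sup>2) * h j))"
      using res0[of _ C0 C D D0] fin0 CD by (simp add: h1 mult.assoc)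
    ultimately show ?thesis by (simp add: res_sum_def)
  qed
  have fac: "(1 + X + 1) / (1 + X - 1) * ((1 - X + 1) / (1 - X - 1)) = 1 - 4 / X\<^sup>2"
    using X0 by (simp add: divide_simps power2_eq_square) (simp add: algebra_simps)
  have "up D (1 + X) * up C (1 - X) + up C (1 + X) * up D (1 - X) =
    ((1 + X + 1) / (1 + X - 1) * ((1 - X + 1) / (1 - X - 1))) *
      (up D0 (1 + X) * up C0 (1 - X) + up C0 (1 + X) * up D0 (1 - X))"
    using fin0 CD by (simp add: up_insert algebra_simps)
  then have up0: "up D (1 + X) * up C (1 - X) + up C (1 + X) * up D (1 - X) =
    (1 - 4 / X\<^sup>2) * (2 + 2 * res_sum C0 D0 (\<lambda>j. (of_nat j - 1) / (X\<^sup>2 - (of_nat j - 1)\<^sup>2)))"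
    unfolding fac using up_sym_sum[OF fin0 pos0 one0 X1] by simp
  \<comment> \<open>The value of the reduced \<phi> at 0; it turns the \<open>1 / v\<close> terms
    below into the last summand of the claim.\<close>
  have z0: "up C0 1 * up D0 1 = 1 - res_sum C0 D0 (\<lambda>j. 1 / (of_nat j - 1))"
  proof -
    have "of_nat j \<noteq> (1::complex)" if "j \<in> C0 \<union> D0" for j
      using that CD by (metis Un_iff of_nat_1 of_nat_eq_iff)
    then have "up D0 (1 + 0) * up C0 (1 - 0) = 1 + (\<Sum>j\<in>D0. res C0 D0 j / (0 - (of_nat j - 1)))
         - (\<Sum>k\<in>C0. res D0 C0 k / (0 - (1 - of_nat k)))"
      by (intro up_partial_fractions[OF fin0 pos0 one0]) auto
    also have "(\<Sum>j\<in>D0. res C0 D0 j / (0 - (of_nat j - 1))) = - (\<Sum>j\<in>D0. res C0 D0 j / (of_nat j - 1))"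
      unfolding sum_negf[symmetric] by (intro sum.cong) (auto simp: minus_divide_right)
    finally show ?thesis by (simp add: res_sum_def mult.commute)
  qed
  have "(1 - 4 / X\<^sup>2) * (a + X\<^sup>2) * res_sum C0 D0 (\<lambda>j. (of_nat j - 1) / (X\<^sup>2 - (of_nat j - 1)\<^sup>2))
      + res_sum C D h = res_sum C0 D0 (\<lambda>j. (1 - 4 / X\<^sup>2) * (a + X\<^sup>2) * ((of_nat j - 1) / (X\<^sup>2 - (of_nat j - 1)\<^sup>2))
      + (1 - 4 / (of_nat j - 1)\<^sup>2) * h j)"
    unfolding rs res_sum_add res_sum_mult by simp
  \<comment> \<open>With \<open>v = j - 1\<close>, each summand splits into \<open>v\<close>, whose
    sum is the first moment, and a multiple of \<open>1 / v\<close>, whose sum is given by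
    \<open>z0\<close>.\<close>
  also have "\<dots> = res_sum C0 D0 (\<lambda>j. (of_nat j - 1) + (4 * a / X\<^sup>2) * (1 / (of_nat j - 1)))"
  proof (intro res_sum_cong)
    fix j assume j: "j \<in> C0 \<union> D0"
    define v where "v = of_nat j - (1::complex)"
    have "of_nat j \<noteq> (1::complex)" using j CD by (metis Un_iff of_nat_1 of_nat_eq_iff)
    then have "v \<noteq> 0" by (simp add: v_def)
    moreover have "X\<^sup>2 - v\<^sup>2 \<noteq> 0" "v\<^sup>2 - X\<^sup>2 \<noteq> 0" using X1[OF j] by (auto simp: v_def)
    ultimately have "(1 - 4 / X\<^sup>2) * (a + X\<^sup>2) * (v / (X\<^sup>2 - v\<^sup>2))
      + (1 - 4 / v\<^sup>2) * (v * (a + v\<^sup>2) / (v\<^sup>2 - X\<^sup>2)) = v + (4 * a / X\<^sup>2) * (1 / v)"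
      using X0 by (simp add: divide_simps) (simp add: algebra_simps power2_eq_square)
    then show "(1 - 4 / X\<^sup>2) * (a + X\<^sup>2) * ((of_nat j - 1) / (X\<^sup>2 - (of_nat j - 1)\<^sup>2))
      + (1 - 4 / (of_nat j - 1)\<^sup>2) * h j = (of_nat j - 1) + (4 * a / X\<^sup>2) * (1 / (of_nat j - 1))"
      unfolding v_def h_def .
  qed
  also have "\<dots> = 2 * (wsum C0 - wsum D0)\<^sup>2 - 2 * (wsum C0 + wsum D0)
      + 4 * a / X\<^sup>2 * (1 - up C0 1 * up D0 1)"
    unfolding res_sum_add res_sum_mult res_sum_first_moment[OF fin0 pos0 one0] z0 by simp
  finally have main: "(1 - 4 / X\<^sup>2) * (a + X\<^sup>2) * res_sum C0 D0 (\<lambda>j. (of_nat j - 1) / (X\<^sup>2 - (of_nat j - 1)\<^sup>2))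
      + res_sum C D h = 2 * (wsum C0 - wsum D0)\<^sup>2 - 2 * (wsum C0 + wsum D0)
      + 4 * a / X\<^sup>2 * (1 - up C0 1 * up D0 1)" .
  have w: "wsum C = wsum C0 + 1" "wsum D = wsum D0 + 1" using CD fin0 by (auto simp: wsum_def)
  have q: "(1 - 4 / X\<^sup>2) * (a + X\<^sup>2) = a + X\<^sup>2 - 4 - 4 * a / X\<^sup>2"
    using X0 by (simp add: field_simps)
  have "u * (v * (2 + 2 * l)) / 2 = v * u + v * u * l" for u v l :: complex
    by (simp add: field_simps)
  then have "(a + X\<^sup>2) * (up D (1 + X) * up C (1 - X) + up C (1 + X) * up D (1 - X)) / 2 + res_sum C D h
      = a + X\<^sup>2 - 4 - 4 * a / X\<^sup>2 + (2 * (wsum C0 - wsum D0)\<^sup>2 - 2 * (wsum C0 + wsum D0)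
      + 4 * a / X\<^sup>2 * (1 - up C0 1 * up D0 1))"
    unfolding up0 q[symmetric] main[symmetric] by simp
  moreover have "f = y - 4 - e + (v + e * (1 - p * q)) \<Longrightarrow> f + e * p * q = y + v - 4"
    for f y e v p q :: complex
    by (simp add: algebra_simps)
  ultimately have "(a + X\<^sup>2) * (up D (1 + X) * up C (1 - X) + up C (1 + X) * up D (1 - X)) / 2 + res_sum C D h
      + 4 * a / X\<^sup>2 * up C0 1 * up D0 1
    = a + X\<^sup>2 + (2 * (wsum C0 - wsum D0)\<^sup>2 - 2 * (wsum C0 + wsum D0)) - 4"
    by blast
  also have "\<dots> = a + X\<^sup>2 + 2 * (wsum C - wsum D)\<^sup>2 - 2 * (wsum C + wsum D)"
    unfolding w by (simp add: algebra_simps)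
  finally have "(a + X\<^sup>2) * (up D (1 + X) * up C (1 - X) + up C (1 + X) * up D (1 - X)) / 2 + res_sum C D h
      + 4 * a / X\<^sup>2 * up C0 1 * up D0 1
    = a + X\<^sup>2 + 2 * (wsum C - wsum D)\<^sup>2 - 2 * (wsum C + wsum D)" .
  then show ?thesis using True unfolding h_def C0_def D0_def by simp
qed

section \<open>Weighted sums over index sets\<close>

definition sg :: "nat \<Rightarrow> nat \<Rightarrow> complex" where
  "sg i k = (if k < i then 1 else - 1)"

definition ratio :: "nat \<Rightarrow> nat \<Rightarrow> real" where
  "ratio i k = \<bar>(real i + real k) / (real i - real k)\<bar>"

text \<open>For \<open>\<alpha> i = par a i * z ^ i\<close>,
  \<open>\<beta> i = par b i * w ^ i\<close> and \<open>P = idx n m\<close> this is the summand of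
  \<open>I\<close> in \<open>umemura 0 n m z w a b\<close>. A free \<open>P\<close> allows single
  indices to be split off.\<close>

definition wt :: "nat \<Rightarrow> (nat \<Rightarrow> complex) \<Rightarrow> (nat \<Rightarrow> complex) \<Rightarrow> nat set \<Rightarrow> nat set \<Rightarrow> complex" where
  "wt n \<alpha> \<beta> P I = of_real (\<Prod>i\<in>I. \<Prod>j\<in>P - I. ratio i j) * (- 1) ^ c_exp n I
     * (\<Prod>i\<in>I. \<alpha> i) * (\<Prod>i\<in>P - I. \<beta> i)"

text \<open>The common core of the weighted sums at \<open>i\<close> and \<open>- i\<close>: once
  the ratios to \<open>i\<close> are cancelled or pulled out, only the signs of \<open>i - k\<close>
  remain.\<close>

definition csum :: "nat \<Rightarrow> (nat \<Rightarrow> complex) \<Rightarrow> (nat \<Rightarrow> complex) \<Rightarrow> nat \<Rightarrow> nat set \<Rightarrow> complex" where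
  "csum n \<alpha> \<beta> i Q = (\<Sum>I\<in>Pow Q. wt n \<alpha> \<beta> Q I * (\<Prod>k\<in>I. sg i k))"

lemma ratio_commute: "ratio i j = ratio j i"
  unfolding ratio_def abs_divide by (simp add: add.commute abs_minus_commute)

lemma ratio_eq: "i \<noteq> k \<Longrightarrow> of_real (ratio i k) = sg i k * ((of_nat i + of_nat k) / (of_nat i - of_nat k))"
proof (cases "k < i")
  case True
  then have "ratio i k = (real i + real k) / (real i - real k)" by (simp add: ratio_def)
  then show ?thesis using True by (simp add: sg_def)
next
  case False
  assume "i \<noteq> k"
  with False have "\<bar>real i - real k\<bar> = - (real i - real k)" by simp
  then have "ratio i k = - ((real i + real k) / (real i - real k))"
    unfolding ratio_def abs_divide by (simp only: minus_divide_right)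
  then show ?thesis using False by (simp add: sg_def minus_divide_left)
qed

lemma sg_square [simp]: "sg i k * sg i k = 1"
  by (simp add: sg_def)

lemma c_exp_insert: "finite I \<Longrightarrow> p \<notin> I \<Longrightarrow> c_exp n (insert p I) = c_exp n {p} + c_exp n I"
proof -
  assume *: "finite I" "p \<notin> I"
  have "{i \<in> insert p I. n < i} = {i \<in> {p}. n < i} \<union> {i \<in> I. n < i}" by auto
  then show ?thesis unfolding c_exp_def using * by (subst sum.union_disjoint[symmetric]) auto
qed

lemma wt_insert_out:
  assumes "finite Q" "p \<notin> Q" "I \<subseteq> Q"
  shows "wt n \<alpha> \<beta> (insert p Q) I = wt n \<alpha> \<beta> Q I * \<beta> p * (\<Prod>i\<in>I. of_real (ratio p i))"
proof -
  have "insert p Q - I = insert p (Q - I)" using assms by auto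
  then show ?thesis using assms
    by (simp add: wt_def prod.distrib ratio_commute[of p])
qed

lemma wt_insert_in:
  assumes "finite Q" "p \<notin> Q" "I \<subseteq> Q"
  shows "wt n \<alpha> \<beta> (insert p Q) (insert p I) =
    wt n \<alpha> \<beta> Q I * \<alpha> p * (- 1) ^ c_exp n {p} * (\<Prod>j\<in>Q - I. of_real (ratio p j))"
proof -
  have *: "insert p Q - insert p I = Q - I" "p \<notin> I" "finite I" using assms by (auto intro: finite_subset)
  show ?thesis
    unfolding wt_def *(1) c_exp_insert[OF *(3,2)] prod.insert[OF *(3,2)] by (simp add: power_add)
qed

lemma sum_Pow_insert:
  assumes "finite Q" "p \<notin> Q"
  shows "sum f (Pow (insert p Q)) = (\<Sum>I\<in>Pow Q. f I) + (\<Sum>I\<in>Pow Q. f (insert p I))"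
proof -
  have "inj_on (insert p) (Pow Q)" using assms unfolding inj_on_def by (metis Pow_iff insert_ident subsetD)
  then show ?thesis using assms
    by (subst Pow_insert, subst sum.union_disjoint) (auto simp: sum.reindex)
qed

lemma up_ratio:
  assumes "finite C" "i \<notin> C"
  shows "(\<Prod>k\<in>C. of_real (ratio i k)) = (\<Prod>k\<in>C. sg i k) * up C (of_nat i)"
  unfolding up_def prod.distrib[symmetric] using assms
  by (intro prod.cong refl ratio_eq) auto

text \<open>\<open>up C (- i)\<close> is the reciprocal of \<open>up C i\<close>, so it undoes the
  ratios up to sign.\<close>

lemma up_neg_ratio:
  assumes "finite C" "i \<notin> C" "0 \<notin> C"
  shows "(\<Prod>k\<in>C. of_real (ratio i k)) * up C (- of_nat i) = (\<Prod>k\<in>C. sg i k)"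
proof -
  have "of_real (ratio i k) * ((- of_nat i + of_nat k) / (- of_nat i - of_nat k)) = sg i k" if "k \<in> C" for k
  proof -
    have "k \<noteq> i" "k > 0" using assms that by (metis, metis gr0I)
    then have "(of_nat (i + k) :: complex) \<noteq> 0" unfolding of_nat_eq_0_iff by simp
    then have n: "(of_nat i - of_nat k :: complex) \<noteq> 0" "(of_nat i + of_nat k :: complex) \<noteq> 0"
      using \<open>k \<noteq> i\<close> by simp_all
    then have "- of_nat i - of_nat k \<noteq> (0::complex)" by (metis add_uminus_conv_diff minus_add_distrib neg_equal_0_iff_equal)
    then have q: "(of_nat i + of_nat k) / (of_nat i - of_nat k) * ((- of_nat i + of_nat k) / (- of_nat i - of_nat k)) = (1::complex)"
      using n by (simp add: divide_simps) (simp add: algebra_simps)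
    show ?thesis unfolding ratio_eq[OF \<open>k \<noteq> i\<close>[symmetric]] mult.assoc q by simp
  qed
  then show ?thesis unfolding up_def prod.distrib[symmetric] by (intro prod.cong) auto
qed

lemma prod_sg_Diff:
  assumes "finite Q" "I \<subseteq> Q"
  shows "(\<Prod>k\<in>Q - I. sg i k) = (\<Prod>k\<in>Q. sg i k) * (\<Prod>k\<in>I. sg i k)"
proof -
  have "(\<Prod>k\<in>I. sg i k) * (\<Prod>k\<in>I. sg i k) = 1" by (simp add: prod.distrib[symmetric])
  moreover have "(\<Prod>k\<in>Q. sg i k) = (\<Prod>k\<in>Q - I. sg i k) * (\<Prod>k\<in>I. sg i k)"
    using assms by (simp add: prod.subset_diff)
  ultimately show ?thesis by (simp add: mult.assoc)
qed

lemma up_mem_zero: "finite C \<Longrightarrow> i \<in> C \<Longrightarrow> up C (- of_nat i) = 0"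
  unfolding up_def by (intro prod_zero) auto

lemma up_Diff_eq:
  assumes "finite Q" "J \<subseteq> Q"
  shows "up Q x = up (Q - J) x * up J x"
  unfolding up_def using assms by (simp add: prod.subset_diff)

section \<open>Weighted sums evaluated at the points \<open>i\<close> and \<open>- i\<close>\<close>

context
  fixes n :: nat and \<alpha> \<beta> :: "nat \<Rightarrow> complex" and Q :: "nat set" and i :: nat
  assumes Q: "finite Q" "i \<notin> Q" "0 \<notin> Q"
begin

text \<open>Subsets without \<open>i\<close> drop out because \<open>- i\<close> is a zero of the
  factor of \<open>i\<close>. For the others, \<open>up\<close> at \<open>- i\<close> cancels the
  ratios between \<open>i\<close> and the complement; the remaining signs over \<open>Q - I\<close>
  are those over \<open>Q\<close> times those over \<open>I\<close>.\<close>

lemma sum_up_neg_compl: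
  "(\<Sum>I\<in>Pow (insert i Q). wt n \<alpha> \<beta> (insert i Q) I * up (insert i Q - I) (- of_nat i))
    = \<alpha> i * (- 1) ^ c_exp n {i} * (\<Prod>k\<in>Q. sg i k) * csum n \<alpha> \<beta> i Q"
proof -
  have "up (insert i Q - I) (- of_nat i) = 0" if "I \<in> Pow Q" for I
    using Q that by (intro up_mem_zero) auto
  moreover have "wt n \<alpha> \<beta> (insert i Q) (insert i I) * up (insert i Q - insert i I) (- of_nat i) =
    \<alpha> i * (- 1) ^ c_exp n {i} * (\<Prod>k\<in>Q. sg i k) * (wt n \<alpha> \<beta> Q I * (\<Prod>k\<in>I. sg i k))" if "I \<in> Pow Q" for I
  proof -
    have I: "I \<subseteq> Q" using that by simp
    have "insert i Q - insert i I = Q - I" using Q by auto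
    then have "wt n \<alpha> \<beta> (insert i Q) (insert i I) * up (insert i Q - insert i I) (- of_nat i) =
      wt n \<alpha> \<beta> Q I * \<alpha> i * (- 1) ^ c_exp n {i} * ((\<Prod>j\<in>Q - I. of_real (ratio i j)) * up (Q - I) (- of_nat i))"
      using wt_insert_in[OF Q(1,2) I, of n \<alpha> \<beta>] by simp
    also have "(\<Prod>j\<in>Q - I. of_real (ratio i j)) * up (Q - I) (- of_nat i) = (\<Prod>k\<in>Q - I. sg i k)"
      using Q by (intro up_neg_ratio) auto
    finally show ?thesis by (simp add: prod_sg_Diff[OF Q(1) I])
  qed
  ultimately show ?thesis
    unfolding sum_Pow_insert[OF Q(1,2)] csum_def sum_distrib_left by simp
qed

lemma sum_up_neg:
  "(\<Sum>I\<in>Pow (insert i Q). wt n \<alpha> \<beta> (insert i Q) I * up I (- of_nat i)) = \<beta> i * csum n \<alpha> \<beta> i Q"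
proof -
  have "up (insert i I) (- of_nat i) = 0" if "I \<in> Pow Q" for I
    using Q that by (intro up_mem_zero) (auto intro: finite_subset)
  moreover have "wt n \<alpha> \<beta> (insert i Q) I * up I (- of_nat i) =
    \<beta> i * (wt n \<alpha> \<beta> Q I * (\<Prod>k\<in>I. sg i k))" if "I \<in> Pow Q" for I
  proof -
    have I: "I \<subseteq> Q" using that by simp
    have "(\<Prod>j\<in>I. of_real (ratio i j)) * up I (- of_nat i) = (\<Prod>k\<in>I. sg i k)"
      using Q I by (intro up_neg_ratio) (auto intro: finite_subset)
    then show ?thesis using wt_insert_out[OF Q(1,2) I, of n \<alpha> \<beta>] by simp
  qed
  ultimately show ?thesis
    unfolding sum_Pow_insert[OF Q(1,2)] csum_def sum_distrib_left by simp
qed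

text \<open>The ratios of \<open>i\<close> to \<open>I\<close> are \<open>up I i\<close> up to sign,
  and together with \<open>up (Q - I) i\<close> they form \<open>up Q i\<close>, which does not
  depend on \<open>I\<close>.\<close>

lemma sum_up_compl:
  "(\<Sum>I\<in>Pow Q. wt n \<alpha> \<beta> (insert i Q) I * up (Q - I) (of_nat i))
    = \<beta> i * up Q (of_nat i) * csum n \<alpha> \<beta> i Q"
proof -
  have "wt n \<alpha> \<beta> (insert i Q) I * up (Q - I) (of_nat i) =
    \<beta> i * up Q (of_nat i) * (wt n \<alpha> \<beta> Q I * (\<Prod>k\<in>I. sg i k))" if "I \<in> Pow Q" for I
  proof -
    have I: "I \<subseteq> Q" using that by simp
    then have "(\<Prod>j\<in>I. of_real (ratio i j)) = (\<Prod>k\<in>I. sg i k) * up I (of_nat i)"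
      using Q by (intro up_ratio) (auto intro: finite_subset)
    then show ?thesis using wt_insert_out[OF Q(1,2) I, of n \<alpha> \<beta>] up_Diff_eq[OF Q(1) I, of "of_nat i"] by simp
  qed
  then show ?thesis unfolding csum_def sum_distrib_left by simp
qed

lemma sum_up:
  "(\<Sum>I\<in>Pow Q. wt n \<alpha> \<beta> (insert i Q) (insert i I) * up I (of_nat i))
    = \<alpha> i * (- 1) ^ c_exp n {i} * (\<Prod>k\<in>Q. sg i k) * up Q (of_nat i) * csum n \<alpha> \<beta> i Q"
proof -
  have "wt n \<alpha> \<beta> (insert i Q) (insert i I) * up I (of_nat i) =
    \<alpha> i * (- 1) ^ c_exp n {i} * (\<Prod>k\<in>Q. sg i k) * up Q (of_nat i) * (wt n \<alpha> \<beta> Q I * (\<Prod>k\<in>I. sg i k))"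
    if "I \<in> Pow Q" for I
  proof -
    have I: "I \<subseteq> Q" using that by simp
    have "(\<Prod>j\<in>Q - I. of_real (ratio i j)) = (\<Prod>k\<in>Q - I. sg i k) * up (Q - I) (of_nat i)"
      using Q by (intro up_ratio) auto
    then show ?thesis using wt_insert_in[OF Q(1,2) I, of n \<alpha> \<beta>] up_Diff_eq[OF Q(1) I, of "of_nat i"]
      by (simp add: prod_sg_Diff[OF Q(1) I])
  qed
  then show ?thesis unfolding csum_def sum_distrib_left by simp
qed

end

section \<open>Summation of the pair identity over all pairs of subsets\<close>

lemma sum_Pow_compl:
  assumes "finite P"
  shows "(\<Sum>I\<in>Pow P. f (P - I)) = (\<Sum>I\<in>Pow P. f I)"
  by (rule sum.reindex_bij_witness[of _ "\<lambda>I. P - I" "\<lambda>I. P - I"]) (auto simp: double_diff)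

text \<open>This is \<open>pair_identity\<close> multiplied by \<open>h C * h D\<close> and summed
  over all pairs. Every term is a sum of products of a function of \<open>C\<close> and a function
  of \<open>D\<close>, so the double sums factor; exchanging \<open>C\<close> and \<open>D\<close>
  merges mirrored terms.\<close>

lemma weighted_pair_identity:
  fixes h :: "nat set \<Rightarrow> complex" and a X :: complex and P :: "nat set"
  defines "S \<equiv> \<lambda>e. \<Sum>C\<in>Pow P. h C * wsum C ^ e"
  assumes P: "finite P" "0 \<notin> P"
    and X: "\<And>j. j \<in> P \<Longrightarrow> X\<^sup>2 \<noteq> (of_nat j - 1)\<^sup>2" and X0: "X \<noteq> 0"
  shows "(a + X\<^sup>2) * (S 0)\<^sup>2 + 4 * (S 2 * S 0 - (S 1)\<^sup>2) - 4 * S 1 * S 0 =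
    (a + X\<^sup>2) * (\<Sum>C\<in>Pow P. h C * up C (1 - X)) * (\<Sum>D\<in>Pow P. h D * up D (1 + X))
    + (\<Sum>j\<in>P. 4 * of_nat j * ((of_nat j - 1) * (a + (of_nat j - 1)\<^sup>2) / ((of_nat j - 1)\<^sup>2 - X\<^sup>2))
        * (\<Sum>C\<in>Pow P. h C * up C (2 - of_nat j))
        * (\<Sum>D\<in>Pow (P - {j}). h (insert j D) * up D (of_nat j)))
    + (if 1 \<in> P then 4 * a / X\<^sup>2 * (\<Sum>D\<in>Pow (P - {1}). h (insert 1 D) * up D 1)\<^sup>2 else 0)"
proof -
  define SS :: "(nat set \<Rightarrow> nat set \<Rightarrow> complex) \<Rightarrow> complex"
    where "SS F = (\<Sum>C\<in>Pow P. \<Sum>D\<in>Pow P. h C * h D * F C D)" for F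
  have SS_prod: "SS (\<lambda>C D. f C * g D) = (\<Sum>C\<in>Pow P. h C * f C) * (\<Sum>D\<in>Pow P. h D * g D)" for f g
    unfolding SS_def sum_product by (intro sum.cong refl) simp
  have SS_swap: "SS (\<lambda>C D. F D C) = SS F" for F
    unfolding SS_def by (subst sum.swap) (intro sum.cong refl, simp)
  have SS_add: "SS (\<lambda>C D. F C D + G C D) = SS F + SS G" for F G
    by (simp add: SS_def sum.distrib algebra_simps)
  have SS_mult: "SS (\<lambda>C D. c * F C D) = c * SS F" for c F
    by (simp add: SS_def sum_distrib_left algebra_simps)
  have SS_sum: "SS (\<lambda>C D. \<Sum>j\<in>P. F j C D) = (\<Sum>j\<in>P. SS (F j))" for F :: "nat \<Rightarrow> nat set \<Rightarrow> nat set \<Rightarrow> complex"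
  proof -
    have "SS (\<lambda>C D. \<Sum>j\<in>P. F j C D) = (\<Sum>C\<in>Pow P. \<Sum>j\<in>P. \<Sum>D\<in>Pow P. h C * h D * F j C D)"
      unfolding SS_def sum_distrib_left by (intro sum.cong refl sum.swap)
    also have "\<dots> = (\<Sum>j\<in>P. SS (F j))"
      unfolding SS_def by (rule sum.swap)
    finally show ?thesis .
  qed
  define \<kappa> where "\<kappa> = (\<lambda>j::nat. (of_nat j - 1) * (a + (of_nat j - 1)\<^sup>2) / ((of_nat j - 1)\<^sup>2 - X\<^sup>2))"
  define E where "E = (\<lambda>C D. a + X\<^sup>2 + 2 * (wsum C - wsum D)\<^sup>2 - 2 * (wsum C + wsum D))"
  define A where "A = (\<lambda>C D. up D (1 + X) * up C (1 - X))"
  define R where "R = (\<lambda>C D. \<Sum>j\<in>D. res C D j * \<kappa> j)"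
  define T where "T = (\<lambda>C D. if 1 \<in> C \<and> 1 \<in> D then 4 * a / X\<^sup>2 * up (C - {1}) 1 * up (D - {1}) 1 else 0)"
  \<comment> \<open>Residues at \<open>j - 1\<close> occur only for sets containing
    \<open>j\<close>, which are parametrised by the subsets of \<open>P - {j}\<close>.\<close>
  have restrict: "(\<Sum>D\<in>Pow P. if j \<in> D then g D else 0) = (\<Sum>D\<in>Pow (P - {j}). g (insert j D))"
    if "j \<in> P" for j and g :: "nat set \<Rightarrow> complex"
  proof -
    have "P = insert j (P - {j})" using that by auto
    then have "(\<Sum>D\<in>Pow P. if j \<in> D then g D else 0) = (\<Sum>D\<in>Pow (insert j (P - {j})). if j \<in> D then g D else 0)"
      by simp
    also have "\<dots> = (\<Sum>D\<in>Pow (P - {j}). if j \<in> D then g D else 0) + (\<Sum>D\<in>Pow (P - {j}). g (insert j D))"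
      using P by (subst sum_Pow_insert) auto
    also have "(\<Sum>D\<in>Pow (P - {j}). if j \<in> D then g D else 0) = 0" by (intro sum.neutral) auto
    finally show ?thesis by simp
  qed
  have ins: "insert j D - {j} = D" if "D \<in> Pow (P - {j})" for j D
    using that by auto
  have "SS E = SS (\<lambda>C D. ((a + X\<^sup>2) / 2) * (A C D + A D C) + (R C D + R D C) + T C D)"
    unfolding SS_def
  proof (intro sum.cong refl)
    fix C D assume "C \<in> Pow P" "D \<in> Pow P"
    then have "finite C" "finite D" "0 \<notin> C" "0 \<notin> D" "\<And>j. j \<in> C \<union> D \<Longrightarrow> X\<^sup>2 \<noteq> (of_nat j - 1)\<^sup>2"
      using P X by (auto intro: finite_subset)
    from pair_identity[OF this X0, of a]
    have "E C D = ((a + X\<^sup>2) / 2) * (A C D + A D C) + (R C D + R D C) + T C D"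
      unfolding E_def A_def R_def T_def res_sum_def \<kappa>_def by simp
    then show "h C * h D * E C D = h C * h D * (((a + X\<^sup>2) / 2) * (A C D + A D C) + (R C D + R D C) + T C D)"
      by simp
  qed
  also have "\<dots> = (a + X\<^sup>2) * SS A + 2 * SS R + SS T"
    by (simp only: SS_add SS_mult SS_swap[of A] SS_swap[of R]) simp
  finally have 1: "SS E = (a + X\<^sup>2) * SS A + 2 * SS R + SS T" .
  have 2: "(a + X\<^sup>2) * SS A = (a + X\<^sup>2) * (\<Sum>C\<in>Pow P. h C * up C (1 - X)) * (\<Sum>D\<in>Pow P. h D * up D (1 + X))"
    unfolding A_def using SS_prod[of "\<lambda>C. up C (1 - X)" "\<lambda>D. up D (1 + X)"] by (simp add: mult.commute)
  have 3: "2 * SS R = (\<Sum>j\<in>P. 4 * of_nat j * \<kappa> j * (\<Sum>C\<in>Pow P. h C * up C (2 - of_nat j))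
        * (\<Sum>D\<in>Pow (P - {j}). h (insert j D) * up D (of_nat j)))"
  proof -
    have "R C D = (\<Sum>j\<in>P. 2 * of_nat j * \<kappa> j * (up C (2 - of_nat j) * (if j \<in> D then up (D - {j}) (of_nat j) else 0)))"
      if "D \<in> Pow P" for C D
    proof -
      have "R C D = (\<Sum>j\<in>P. if j \<in> D then res C D j * \<kappa> j else 0)"
      proof -
        have "P \<inter> D = D" using that by auto
        then show ?thesis
          unfolding R_def using sum.inter_restrict[OF P(1), of "\<lambda>j. res C D j * \<kappa> j" D] by simp
      qed
      also have "\<dots> = (\<Sum>j\<in>P. 2 * of_nat j * \<kappa> j * (up C (2 - of_nat j) * (if j \<in> D then up (D - {j}) (of_nat j) else 0)))"
        by (intro sum.cong refl) (simp add: res_def)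
      finally show ?thesis .
    qed
    then have "SS R = SS (\<lambda>C D. \<Sum>j\<in>P. 2 * of_nat j * \<kappa> j * (up C (2 - of_nat j) * (if j \<in> D then up (D - {j}) (of_nat j) else 0)))"
      unfolding SS_def by (intro sum.cong refl) simp
    also have "\<dots> = (\<Sum>j\<in>P. SS (\<lambda>C D. 2 * of_nat j * \<kappa> j * (up C (2 - of_nat j) * (if j \<in> D then up (D - {j}) (of_nat j) else 0))))"
      by (rule SS_sum)
    also have "\<dots> = (\<Sum>j\<in>P. 2 * of_nat j * \<kappa> j * ((\<Sum>C\<in>Pow P. h C * up C (2 - of_nat j))
        * (\<Sum>D\<in>Pow (P - {j}). h (insert j D) * up D (of_nat j))))"
    proof (intro sum.cong refl)
      fix j assume j: "j \<in> P"
      have "(\<Sum>D\<in>Pow P. h D * (if j \<in> D then up (D - {j}) (of_nat j) else 0)) =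
          (\<Sum>D\<in>Pow P. if j \<in> D then h D * up (D - {j}) (of_nat j) else 0)"
        by (intro sum.cong refl) simp
      also have "\<dots> = (\<Sum>D\<in>Pow (P - {j}). h (insert j D) * up D (of_nat j))"
        unfolding restrict[OF j] by (intro sum.cong refl) (simp only: ins)
      finally show "SS (\<lambda>C D. 2 * of_nat j * \<kappa> j * (up C (2 - of_nat j) * (if j \<in> D then up (D - {j}) (of_nat j) else 0)))
         = 2 * of_nat j * \<kappa> j * ((\<Sum>C\<in>Pow P. h C * up C (2 - of_nat j))
        * (\<Sum>D\<in>Pow (P - {j}). h (insert j D) * up D (of_nat j)))"
        unfolding SS_mult SS_prod by simp
    qed
    finally show ?thesis
      by (simp only:) (subst sum_distrib_left, intro sum.cong refl, simp add: mult.assoc)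
  qed
  have 4: "SS T = (if 1 \<in> P then 4 * a / X\<^sup>2 * (\<Sum>D\<in>Pow (P - {1}). h (insert 1 D) * up D 1)\<^sup>2 else 0)"
  proof (cases "1 \<in> P")
    case True
    define g where "g = (\<lambda>C. if 1 \<in> C then up (C - {1}) 1 else 0)"
    have "(\<Sum>D\<in>Pow P. h D * g D) = (\<Sum>D\<in>Pow P. if 1 \<in> D then h D * up (D - {1}) 1 else 0)"
      by (intro sum.cong refl) (simp add: g_def)
    also have "\<dots> = (\<Sum>D\<in>Pow (P - {1}). h (insert 1 D) * up D 1)"
      unfolding restrict[OF True] by (intro sum.cong refl) (simp only: ins)
    finally have g: "(\<Sum>D\<in>Pow P. h D * g D) = (\<Sum>D\<in>Pow (P - {1}). h (insert 1 D) * up D 1)" .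
    have "T = (\<lambda>C D. (4 * a / X\<^sup>2) * (g C * g D))" by (auto simp: T_def g_def fun_eq_iff)
    then have "SS T = (4 * a / X\<^sup>2) * (\<Sum>D\<in>Pow P. h D * g D)\<^sup>2"
      by (simp only: SS_mult SS_prod power2_eq_square)
    then show ?thesis using True g by simp
  next
    case False
    then have "SS T = 0" unfolding SS_def T_def by (intro sum.neutral ballI) auto
    then show ?thesis using False by simp
  qed
  have "SS E = (a + X\<^sup>2) * (S 0)\<^sup>2 + 4 * (S 2 * S 0 - (S 1)\<^sup>2) - 4 * S 1 * S 0"
  proof -
    \<comment> \<open>The zeroth powers are written out to give each summand the product form that
      \<open>SS_prod\<close> requires.\<close>
    have E: "E = (\<lambda>C D. (a + X\<^sup>2) * (wsum C ^ 0 * wsum D ^ 0) + (2 * (wsum C ^ 2 * wsum D ^ 0) + (2 * (wsum C ^ 0 * wsum D ^ 2)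
      + ((- 4) * (wsum C ^ 1 * wsum D ^ 1) + ((- 2) * (wsum C ^ 1 * wsum D ^ 0) + (- 2) * (wsum C ^ 0 * wsum D ^ 1))))))"
      by (simp add: E_def fun_eq_iff power2_eq_square algebra_simps)
    show ?thesis unfolding E SS_add SS_mult SS_prod S_def
      by (simp add: power2_eq_square algebra_simps)
  qed
  from this[unfolded 1 2 3 4] show ?thesis unfolding \<kappa>_def by (rule sym)
qed

section \<open>The index set, and the relations between \<open>a\<close>-residues and
  \<open>b\<close>-residues\<close>

lemma idx_iff: "k \<in> idx n m \<longleftrightarrow> (1 \<le> k \<and> k \<le> n) \<or> (n < k \<and> k \<le> n + 2 * m \<and> even (k - n))"
proof
  assume "k \<in> idx n m"
  then show "(1 \<le> k \<and> k \<le> n) \<or> (n < k \<and> k \<le> n + 2 * m \<and> even (k - n))"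
    by (auto simp: idx_def)
next
  assume "(1 \<le> k \<and> k \<le> n) \<or> (n < k \<and> k \<le> n + 2 * m \<and> even (k - n))"
  then show "k \<in> idx n m"
  proof
    assume "n < k \<and> k \<le> n + 2 * m \<and> even (k - n)"
    moreover from this obtain c where "k - n = 2 * c" by (blast elim: evenE)
    ultimately have "k = n + 2 * c" "c \<in> {1..m}" by auto
    then show ?thesis unfolding idx_def by blast
  qed (auto simp: idx_def)
qed

lemma finite_idx [simp]: "finite (idx n m)"
  by (simp add: idx_def)

lemma zero_notin_idx [simp]: "0 \<notin> idx n m"
  by (simp add: idx_iff)

lemma idx_Suc: "idx n (Suc m) = insert (n + 2 * m + 2) (idx n m)"
proof -
  have "{1..Suc m} = insert (Suc m) {1..m}" by auto
  then show ?thesis by (auto simp: idx_def)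
qed

lemma idx_le: "k \<in> idx n m \<Longrightarrow> k \<le> n + 2 * m"
  by (auto simp: idx_iff)

lemma c_exp_singleton: "c_exp n {i} = (if i > n then (i - n) div 2 else 0)"
proof (cases "i > n")
  case True
  then have "{k \<in> {i}. k > n} = {i}" by auto
  then show ?thesis using True by (simp add: c_exp_def)
next
  case False
  then have "{k \<in> {i}. k > n} = {}" by auto
  then show ?thesis using False by (simp only: c_exp_def) simp
qed

text \<open>Only \<open>k = i + 1\<close> compares differently with \<open>i\<close> and \<open>i + 2\<close>, and \<open>i + 1\<close> is an index iff
  \<open>i < n\<close>; otherwise the exponent $\mathbf c$ grows by one in the step from \<open>i\<close> to \<open>i + 2\<close>.\<close>

lemma sign_step:
  assumes "i = 0 \<or> i \<in> idx n m" "i + 2 \<in> idx n m"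
  shows "(\<Prod>k\<in>idx n m - {i, i + 2}. sg i k) * (\<Prod>k\<in>idx n m - {i, i + 2}. sg (i + 2) k)
    * (- 1) ^ c_exp n {i} * (- 1) ^ c_exp n {i + 2} = - 1"
proof -
  define Q where "Q = idx n m - {i, i + 2}"
  have "(\<Prod>k\<in>Q. sg i k) * (\<Prod>k\<in>Q. sg (i + 2) k) = (\<Prod>k\<in>Q. if k = i + 1 then - 1 else 1)"
    unfolding prod.distrib[symmetric] by (intro prod.cong) (auto simp: sg_def Q_def)
  also have "\<dots> = (if i + 1 \<in> Q then - 1 else 1)"
    by (simp add: Q_def)
  also have "i + 1 \<in> Q \<longleftrightarrow> i + 1 \<le> n"
    using assms by (auto simp: Q_def idx_iff)
  finally have 1: "(\<Prod>k\<in>Q. sg i k) * (\<Prod>k\<in>Q. sg (i + 2) k) = (if i + 1 \<le> n then - 1 else 1)" .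
  show ?thesis
  proof (cases "i + 1 \<le> n")
    case True
    \<comment> \<open>Otherwise \<open>i + 2\<close> would be \<open>n + 1\<close>, which is never
      an index.\<close>
    have "n \<noteq> i + 1" using assms(2) by (auto simp: idx_iff)
    with True have "i + 2 \<le> n" by simp
    then show ?thesis using 1 True unfolding Q_def by (simp add: c_exp_singleton)
  next
    case False
    then have "c_exp n {i + 2} = Suc (c_exp n {i})" by (auto simp: c_exp_singleton Suc_diff_le)
    then show ?thesis using 1 False unfolding Q_def
      by (simp add: power_mult_distrib[symmetric] mult.assoc)
  qed
qed

text \<open>Each factor at 0 is \<open>- 1\<close>. This serves the case \<open>j = 2\<close> below,
  where the point \<open>2 - j\<close> is 0.\<close>

lemma up_zero: "0 \<notin> C \<Longrightarrow> up C 0 = (\<Prod>k\<in>C. sg 0 k)"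
  unfolding up_def by (intro prod.cong) (auto simp: sg_def intro!: gr0I)

text \<open>Termwise, this moves \<open>j - 2\<close> out of \<open>I\<close> and \<open>j\<close> into \<open>J\<close>. The index \<open>0\<close>, needed for \<open>j = 2\<close>,
  behaves as if it belonged to every \<open>I\<close>.\<close>

lemma link_identity:
  fixes z w a b :: complex and n m j :: nat and \<alpha> \<beta> :: "nat \<Rightarrow> complex"
  defines "P \<equiv> idx n m"
  assumes \<alpha>0: "\<alpha> 0 = 1" and \<beta>0: "\<beta> 0 = 1"
    and \<alpha>: "\<And>i. \<alpha> (i + 2) = bar a (i + 2) * z\<^sup>2 * \<alpha> i"
    and \<beta>: "\<And>i. \<beta> (i + 2) = bar b (i + 2) * w\<^sup>2 * \<beta> i"
    and j: "j \<in> P" "j \<ge> 2"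
  shows "z\<^sup>2 * bar a j * (\<Sum>I\<in>Pow P. wt n \<alpha> \<beta> P I * up (P - I) (2 - of_nat j))
      * (\<Sum>J\<in>Pow (P - {j}). wt n \<alpha> \<beta> P J * up (P - {j} - J) (of_nat j))
    = w\<^sup>2 * bar b j * (\<Sum>I\<in>Pow P. wt n \<alpha> \<beta> P I * up I (2 - of_nat j))
      * (\<Sum>J\<in>Pow (P - {j}). wt n \<alpha> \<beta> P (insert j J) * up J (of_nat j))"
proof -
  obtain i where i: "j = i + 2" using j(2) by (metis add.commute le_Suc_ex)
  have P: "finite P" "0 \<notin> P" by (auto simp: P_def)
  have ii: "i = 0 \<or> i \<in> P" using j by (auto simp: P_def idx_iff i)
  define Q where "Q = P - {i, j}"
  have Pj: "P = insert j (P - {j})" "P - {j} = (if i = 0 then Q else insert i Q)"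
    using j ii P by (auto simp: Q_def i)
  have nQ: "finite Q" "i \<notin> Q" "j \<notin> Q" "0 \<notin> Q" using P by (auto simp: Q_def)
  define p q ei ej :: complex where "p = (\<Prod>k\<in>Q. sg i k)" and "q = (\<Prod>k\<in>Q. sg j k)"
    and "ei = (- 1) ^ c_exp n {i}" and "ej = (- 1) ^ c_exp n {j}"
  have "p * q * ei * ej = - 1"
    using sign_step[of i n m] ii j unfolding p_def q_def ei_def ej_def Q_def i P_def by simp
  moreover have "q * q = 1" unfolding q_def by (simp add: prod.distrib[symmetric])
  moreover have "ej * ej = 1" unfolding ej_def by (simp add: power_mult_distrib[symmetric])
  \<comment> \<open>By the recursions for \<open>\<alpha>\<close> and \<open>\<beta>\<close>, both
    sides of the claim are the same product up to the signs \<open>- (p * ei)\<close> and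
    \<open>q * ej\<close>.\<close>
  ultimately have sgn: "- (p * ei) = q * ej"
    by algebra
  have two: "2 - of_nat j = - (of_nat i :: complex)" by (simp add: i)
  \<comment> \<open>Both sums at \<open>- i\<close> are multiples of one signed sum
    \<open>K\<close>, taken over the subsets of \<open>P - {i}\<close>, which is \<open>P\<close>
    itself if \<open>i = 0\<close>.\<close>
  obtain K where K: "(\<Sum>I\<in>Pow P. wt n \<alpha> \<beta> P I * up (P - I) (2 - of_nat j)) = \<alpha> i * ei * (- p) * K"
    "(\<Sum>I\<in>Pow P. wt n \<alpha> \<beta> P I * up I (2 - of_nat j)) = \<beta> i * K"
  proof (cases "i = 0")
    case True
    have Pp: "(\<Prod>k\<in>P. sg 0 k) = - p"
    proof -
      have "P = insert j Q" using Pj True by simp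
      then show ?thesis using nQ by (simp add: p_def True sg_def)
    qed
    have e: "ei = 1" by (simp add: ei_def True c_exp_singleton)
    have "wt n \<alpha> \<beta> P I * up (P - I) 0 = - p * (wt n \<alpha> \<beta> P I * (\<Prod>k\<in>I. sg 0 k))" if "I \<in> Pow P" for I
      using that P prod_sg_Diff[of P I 0] by (simp add: up_zero Pp)
    moreover have "up I 0 = (\<Prod>k\<in>I. sg 0 k)" if "I \<in> Pow P" for I
      using that P by (intro up_zero) auto
    ultimately show ?thesis
      by (intro that[of "csum n \<alpha> \<beta> 0 P"])
        (simp_all add: True two \<alpha>0 \<beta>0 e csum_def sum_distrib_left)
  next
    case False
    define Qi where "Qi = P - {i}"
    have Qi: "finite Qi" "i \<notin> Qi" "0 \<notin> Qi" "P = insert i Qi" "Qi = insert j Q"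
      using P ii False j by (auto simp: Qi_def Q_def i)
    \<comment> \<open>Besides \<open>Q\<close>, the set \<open>Qi\<close> contains
      \<open>j = i + 2\<close>, whose sign relative to \<open>i\<close> is
      \<open>- 1\<close>.\<close>
    have "(\<Prod>k\<in>Qi. sg i k) = - p"
      using nQ Qi by (simp add: p_def sg_def i)
    with sum_up_neg_compl[OF Qi(1,2,3), of n \<alpha> \<beta>] sum_up_neg[OF Qi(1,2,3), of n \<alpha> \<beta>]
    show ?thesis
      by (intro that[of "csum n \<alpha> \<beta> i Qi"]) (simp_all add: two Qi(4)[symmetric] ei_def)
  qed
  define Qj where "Qj = P - {j}"
  have Qj: "finite Qj" "j \<notin> Qj" "0 \<notin> Qj" "P = insert j Qj"
    using P j by (auto simp: Qj_def)
  have "(\<Prod>k\<in>Qj. sg j k) = q"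
  proof (cases "i = 0")
    case True
    then show ?thesis using Pj by (simp add: Qj_def q_def)
  next
    case False
    then show ?thesis using Pj nQ by (simp add: Qj_def q_def sg_def i)
  qed
  then have L: "(\<Sum>J\<in>Pow Qj. wt n \<alpha> \<beta> P J * up (Qj - J) (of_nat j)) = \<beta> j * up Qj (of_nat j) * csum n \<alpha> \<beta> j Qj"
    "(\<Sum>J\<in>Pow Qj. wt n \<alpha> \<beta> P (insert j J) * up J (of_nat j)) = \<alpha> j * ej * q * up Qj (of_nat j) * csum n \<alpha> \<beta> j Qj"
    using sum_up_compl[OF Qj(1,2,3), of n \<alpha> \<beta>] sum_up[OF Qj(1,2,3), of n \<alpha> \<beta>]
    by (simp_all add: Qj(4)[symmetric] ej_def)
  have "\<alpha> j = bar a j * z\<^sup>2 * \<alpha> i" "\<beta> j = bar b j * w\<^sup>2 * \<beta> i" using \<alpha> \<beta> by (simp_all add: i)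
  then show ?thesis
    unfolding K Qj_def[symmetric] L using sgn by algebra
qed

text \<open>This collects the residues at \<open>X\<close> and \<open>- X\<close> for
  \<open>X = N + 1\<close>. As \<open>N\<close> is the largest element of \<open>P\<close>, the sums
  at \<open>- N\<close> reduce to \<open>[n;m-1]\<close> with all signs 1. The sums at
  \<open>N + 2\<close> are, up to factors, the parts of \<open>V (m + 1)\<close> without and with
  the new index \<open>N + 2\<close>.\<close>

lemma top_identity:
  fixes z w a b :: complex and n m :: nat and \<alpha> \<beta> :: "nat \<Rightarrow> complex"
  defines "P \<equiv> idx n m" and "N \<equiv> n + 2 * m"
  defines "V \<equiv> \<lambda>l. \<Sum>I\<in>Pow (idx n l). wt n \<alpha> \<beta> (idx n l) I"
  assumes m: "m \<ge> 1"
    and \<alpha>: "\<And>i. \<alpha> (i + 2) = bar a (i + 2) * z\<^sup>2 * \<alpha> i"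
    and \<beta>: "\<And>i. \<beta> (i + 2) = bar b (i + 2) * w\<^sup>2 * \<beta> i"
  shows "V (m - 1) * V (m + 1) =
    w\<^sup>2 * bar b (N + 2) * (\<Sum>I\<in>Pow P. wt n \<alpha> \<beta> P I * up I (- of_nat N))
      * (\<Sum>J\<in>Pow P. wt n \<alpha> \<beta> P J * up J (of_nat N + 2))
    - z\<^sup>2 * bar a (N + 2) * (\<Sum>I\<in>Pow P. wt n \<alpha> \<beta> P I * up (P - I) (- of_nat N))
      * (\<Sum>J\<in>Pow P. wt n \<alpha> \<beta> P J * up (P - J) (of_nat N + 2))"
proof -
  define Q where "Q = idx n (m - 1)"
  have Q: "P = insert N Q"
  proof -
    have "Suc (m - 1) = m" "n + 2 * (m - 1) + 2 = n + 2 * m" using m by simp_all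
    then show ?thesis using idx_Suc[of n "m - 1"] by (simp only: P_def Q_def N_def)
  qed
  have lt: "k < N" if "k \<in> Q" for k using idx_le[of k n "m - 1"] m that by (auto simp: Q_def N_def)
  have Q': "finite Q" "N \<notin> Q" "0 \<notin> Q" using lt by (auto simp: Q_def)
  have P: "finite P" "N + 2 \<notin> P" using idx_le[of "N + 2" n m] by (auto simp: P_def N_def)
  have ltP: "k < N + 2" if "k \<in> P" for k using idx_le[of k n m] that by (auto simp: P_def N_def)
  have "csum n \<alpha> \<beta> N Q = V (m - 1)"
    unfolding csum_def V_def Q_def[symmetric]
  proof (intro sum.cong refl)
    fix I assume "I \<in> Pow Q"
    then have "(\<Prod>k\<in>I. sg N k) = 1" using lt by (intro prod.neutral) (auto simp: sg_def)
    then show "wt n \<alpha> \<beta> Q I * (\<Prod>k\<in>I. sg N k) = wt n \<alpha> \<beta> Q I" by simp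
  qed
  moreover have "(\<Prod>k\<in>Q. sg N k) = 1" using lt by (intro prod.neutral) (auto simp: sg_def)
  moreover have "c_exp n {N} = m" using m by (simp add: c_exp_singleton N_def)
  ultimately have A: "(\<Sum>I\<in>Pow P. wt n \<alpha> \<beta> P I * up (P - I) (- of_nat N)) = \<alpha> N * (- 1) ^ m * V (m - 1)"
    "(\<Sum>I\<in>Pow P. wt n \<alpha> \<beta> P I * up I (- of_nat N)) = \<beta> N * V (m - 1)"
    using sum_up_neg_compl[OF Q', of n \<alpha> \<beta>] sum_up_neg[OF Q', of n \<alpha> \<beta>] by (simp_all add: Q[symmetric])
  have pr: "(\<Prod>k\<in>C. of_real (ratio (N + 2) k)) = up C (of_nat N + 2)" if "C \<subseteq> P" for C
  proof -
    have "finite C" "N + 2 \<notin> C" using that P by (auto intro: finite_subset)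
    from up_ratio[OF this] have "(\<Prod>k\<in>C. of_real (ratio (N + 2) k)) = (\<Prod>k\<in>C. sg (N + 2) k) * up C (of_nat (N + 2))" .
    moreover have "(\<Prod>k\<in>C. sg (N + 2) k) = 1" using ltP that by (intro prod.neutral) (auto simp: sg_def)
    ultimately show ?thesis by (simp add: add.commute)
  qed
  \<comment> \<open>The exponent is \<open>m + 1\<close> here but \<open>m\<close> for
    \<open>N\<close>; this is the source of the minus sign between the two products.\<close>
  have c: "c_exp n {N + 2} = Suc m" by (simp add: c_exp_singleton N_def)
  have PM: "idx n (m + 1) = insert (N + 2) P" using idx_Suc[of n m] by (simp add: P_def N_def)
  have V1: "V (m + 1) = \<beta> (N + 2) * (\<Sum>J\<in>Pow P. wt n \<alpha> \<beta> P J * up J (of_nat N + 2))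
      - \<alpha> (N + 2) * (- 1) ^ m * (\<Sum>J\<in>Pow P. wt n \<alpha> \<beta> P J * up (P - J) (of_nat N + 2))"
  proof -
    have "wt n \<alpha> \<beta> (insert (N + 2) P) I = \<beta> (N + 2) * (wt n \<alpha> \<beta> P I * up I (of_nat N + 2))"
      "wt n \<alpha> \<beta> (insert (N + 2) P) (insert (N + 2) I) =
        - (\<alpha> (N + 2) * (- 1) ^ m) * (wt n \<alpha> \<beta> P I * up (P - I) (of_nat N + 2))" if "I \<in> Pow P" for I
    proof -
      have I: "I \<subseteq> P" using that by simp
      show "wt n \<alpha> \<beta> (insert (N + 2) P) I = \<beta> (N + 2) * (wt n \<alpha> \<beta> P I * up I (of_nat N + 2))"
        unfolding wt_insert_out[OF P I] pr[OF I] by simp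
      show "wt n \<alpha> \<beta> (insert (N + 2) P) (insert (N + 2) I) =
        - (\<alpha> (N + 2) * (- 1) ^ m) * (wt n \<alpha> \<beta> P I * up (P - I) (of_nat N + 2))"
        unfolding wt_insert_in[OF P I] pr[OF Diff_subset] c by simp
    qed
    then show ?thesis
      unfolding V_def PM sum_Pow_insert[OF P] sum_distrib_left by (simp add: sum_negf)
  qed
  show ?thesis unfolding V1 A \<alpha>[of N] \<beta>[of N] by (simp add: algebra_simps)
qed

section \<open>Umemura polynomials as weighted sums, and the algebraic form of the identity\<close>

lemma par_step: "par a (i + 2) = bar a (i + 2) * par a i"
proof -
  have "{k \<in> {1..i + 2}. even k = even (i + 2)} = insert (i + 2) {k \<in> {1..i}. even k = even i}"
    by (auto simp: le_Suc_eq)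
  then show ?thesis by (simp add: par_def)
qed

lemma par_0: "par a 0 = 1"
  by (simp add: par_def)

lemma par_1: "par a 1 = a"
proof -
  have "{k \<in> {1..1}. even k = even (1::nat)} = {1::nat}" by auto
  then have "par a 1 = bar a 1" unfolding par_def by simp
  then show ?thesis by (simp add: bar_def)
qed

lemma d_coeff_eq: "d_coeff n m I = (\<Prod>i\<in>I. \<Prod>j\<in>idx n m - I. ratio i j)"
  by (simp add: d_coeff_def ratio_def)

lemma umemura_0_eq:
  "umemura 0 n m z w a b = (\<Sum>I\<in>Pow (idx n m).
     wt n (\<lambda>i. par a i * z ^ i) (\<lambda>i. par b i * w ^ i) (idx n m) I)"
proof -
  have "{I. {1..0::nat} \<subseteq> I \<and> I \<subseteq> idx n m} = Pow (idx n m)" by auto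
  then show ?thesis
    unfolding umemura_def
    by (intro sum.cong) (simp_all add: wt_def d_coeff_eq e_term_def power_sum prod.distrib mult_ac)
qed

text \<open>With the sign convention of \<open>umemura\<close>, the prefactor of a set
  \<open>insert 1 I\<close> is \<open>up I 1\<close>, so the sum is an instance of
  \<open>sum_up\<close> at the index 1.\<close>

lemma umemura_1_eq:
  fixes a b z w n m
  defines "\<alpha> \<equiv> \<lambda>i. par a i * z ^ i" and "\<beta> \<equiv> \<lambda>i. par b i * w ^ i" and "Q \<equiv> idx n m - {1}"
  assumes 1: "1 \<in> idx n m"
  shows "umemura 1 n m z w a b = (\<Prod>k\<in>Q. sg 1 k) * up Q 1 * csum n \<alpha> \<beta> 1 Q"
proof -
  define P where "P = idx n m"
  have Q: "finite Q" "1 \<notin> Q" "0 \<notin> Q" "P = insert 1 Q" using 1 by (auto simp: Q_def P_def)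
  have n: "n \<ge> 1" using 1 by (cases n) (auto simp: idx_iff)
  \<comment> \<open>$U^{(1)}$ omits the factor $a_1 z$ of the element 1.\<close>
  define \<alpha>' where "\<alpha>' = \<alpha>(1 := 1)"
  have "umemura 1 n m z w a b = (\<Sum>I\<in>Pow Q. wt n \<alpha>' \<beta> P (insert 1 I) * up I (of_nat 1))"
    unfolding umemura_def
  proof (rule sum.reindex_bij_witness[of _ "insert 1" "\<lambda>I. I - {1}"])
    fix I assume I: "I \<in> {I. {1..1} \<subseteq> I \<and> I \<subseteq> idx n m}"
    then have I1: "insert 1 (I - {1}) = I" "{1..1} = {1::nat}" "finite I" "1 \<in> I"
      by (auto intro: finite_subset)
    have prods: "prod \<alpha>' I = prod \<alpha> (I - {1})"
      using I1 by (subst I1(1)[symmetric], subst prod.insert) (auto simp: \<alpha>'_def intro!: prod.cong)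
    show "wt n \<alpha>' \<beta> P (insert 1 (I - {1})) * up (I - {1}) (of_nat 1) =
      (\<Prod>i\<in>I - {1..1}. \<Prod>j\<in>{1..1}. (of_nat i + of_nat j) / (of_nat j - of_nat i)) *
         complex_of_real (d_coeff n m I) * (- 1) ^ c_exp n I * e_term n m 1 I z w a b"
      unfolding I1 wt_def prods
      by (simp add: I1 up_def d_coeff_eq P_def e_term_def power_sum prod.distrib \<alpha>_def \<beta>_def add.commute mult_ac)
  qed (use Q P_def in \<open>auto simp: P_def\<close>)
  also have "\<dots> = \<alpha>' 1 * (- 1) ^ c_exp n {1} * (\<Prod>k\<in>Q. sg 1 k) * up Q (of_nat 1) * csum n \<alpha>' \<beta> 1 Q"
    unfolding Q(4) by (rule sum_up[OF Q(1-3)])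
  also have "csum n \<alpha>' \<beta> 1 Q = csum n \<alpha> \<beta> 1 Q"
    unfolding csum_def wt_def using Q
    by (intro sum.cong refl arg_cong2[where f = "(*)"] prod.cong) (auto simp: \<alpha>'_def)
  finally show ?thesis using n by (simp add: \<alpha>'_def c_exp_singleton)
qed

text \<open>The bracket in the moments \<open>S e\<close> is the form that the Hirota term takes
  under \<open>hirota_D2_monomial_sum\<close>. The identity thus becomes purely algebraic, with
  \<open>w^2 - z^2 = 1\<close> as the only trace of the variable \<open>x\<close>.\<close>

lemma umemura_algebraic_identity:
  fixes n m :: nat and a b z w :: complex
  defines "P \<equiv> idx n m" and "W \<equiv> wt n (\<lambda>i. par a i * z ^ i) (\<lambda>i. par b i * w ^ i) (idx n m)"
  defines "S \<equiv> \<lambda>e. \<Sum>I\<in>Pow P. W I * wsum I ^ e"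
  assumes m: "m \<ge> 1" and zw: "w\<^sup>2 - z\<^sup>2 = 1"
  shows "umemura 0 n (m - 1) z w a b * umemura 0 n (m + 1) z w a b =
    (- bar a (n + 2 * m + 2) * z\<^sup>2 + bar b (n + 2 * m + 2) * w\<^sup>2) * (S 0)\<^sup>2
    + (4 * (S 2 * S 0 - (S 1)\<^sup>2) - 4 * (z\<^sup>2 + w\<^sup>2) * S 1 * S 0 + 4 * wsum P * z\<^sup>2 * (S 0)\<^sup>2)
    - 4 / (of_nat (n + 2 * m + 1))\<^sup>2 * a * b * (a - b) * z\<^sup>2 * w\<^sup>2 * (umemura 1 n m z w a b)\<^sup>2"
proof -
  define \<alpha> \<beta> where "\<alpha> = (\<lambda>i. par a i * z ^ i)" and "\<beta> = (\<lambda>i. par b i * w ^ i)"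
  have \<alpha>: "\<alpha> (i + 2) = bar a (i + 2) * z\<^sup>2 * \<alpha> i" for i
    unfolding \<alpha>_def par_step by (simp add: power_add power2_eq_square)
  have \<beta>: "\<beta> (i + 2) = bar b (i + 2) * w\<^sup>2 * \<beta> i" for i
    unfolding \<beta>_def par_step by (simp add: power_add power2_eq_square)
  have \<alpha>0: "\<alpha> 0 = 1" and \<beta>0: "\<beta> 0 = 1" by (simp_all add: \<alpha>_def \<beta>_def par_0)
  have W: "W = wt n \<alpha> \<beta> P" by (simp add: W_def \<alpha>_def \<beta>_def P_def)
  define N where "N = n + 2 * m"
  define X :: complex where "X = of_nat (N + 1)"
  have P: "finite P" "0 \<notin> P" by (simp_all add: P_def)
  have X0: "X \<noteq> 0" unfolding X_def of_nat_eq_0_iff by simp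
  have Xp: "X\<^sup>2 \<noteq> (of_nat j - 1)\<^sup>2" if "j \<in> P" for j
  proof
    assume "X\<^sup>2 = (of_nat j - 1)\<^sup>2"
    moreover have j: "1 \<le> j" "j \<le> N" using idx_le[of j n m] that P by (auto simp: P_def N_def idx_iff)
    ultimately have "(of_nat ((N + 1)\<^sup>2) :: complex) = of_nat ((j - 1)\<^sup>2)"
      by (simp add: X_def of_nat_diff)
    then have "(N + 1)\<^sup>2 = (j - 1)\<^sup>2" by (simp only: of_nat_eq_iff)
    then show False using j by (simp add: power2_eq_iff_nonneg)
  qed
  have bX: "c + X\<^sup>2 = bar c (N + 2)" for c by (simp add: bar_def X_def)
  have X1: "1 - X = - of_nat N" "1 + X = of_nat N + 2" by (simp_all add: X_def)
  define \<kappa> :: "nat \<Rightarrow> complex" where "\<kappa> = (\<lambda>j. 4 * of_nat j * ((of_nat j - 1) / ((of_nat j - 1)\<^sup>2 - X\<^sup>2)))"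
  have kb: "4 * of_nat j * ((of_nat j - 1) * (c + (of_nat j - 1)\<^sup>2) / ((of_nat j - 1)\<^sup>2 - X\<^sup>2)) =
      \<kappa> j * bar c j" for j c
    by (simp add: \<kappa>_def bar_def)
  define AN AN' BN BN' where "AN = (\<Sum>I\<in>Pow P. W I * up (P - I) (- of_nat N))"
    and "AN' = (\<Sum>I\<in>Pow P. W I * up I (- of_nat N))"
    and "BN = (\<Sum>J\<in>Pow P. W J * up (P - J) (of_nat N + 2))"
    and "BN' = (\<Sum>J\<in>Pow P. W J * up J (of_nat N + 2))"
  define A A' B B' where "A = (\<lambda>j. \<Sum>I\<in>Pow P. W I * up (P - I) (2 - of_nat j))"
    and "A' = (\<lambda>j. \<Sum>I\<in>Pow P. W I * up I (2 - of_nat j))"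
    and "B = (\<lambda>j. \<Sum>J\<in>Pow (P - {j}). W J * up (P - {j} - J) (of_nat j))"
    and "B' = (\<lambda>j. \<Sum>J\<in>Pow (P - {j}). W (insert j J) * up J (of_nat j))"
  have top: "umemura 0 n (m - 1) z w a b * umemura 0 n (m + 1) z w a b =
      w\<^sup>2 * bar b (N + 2) * AN' * BN' - z\<^sup>2 * bar a (N + 2) * AN * BN"
    using top_identity[OF m \<alpha> \<beta>, of n]
    by (simp add: umemura_0_eq \<alpha>_def[symmetric] \<beta>_def[symmetric] W AN_def BN_def AN'_def BN'_def P_def N_def)
  have b_part: "bar b (N + 2) * (S 0)\<^sup>2 + 4 * (S 2 * S 0 - (S 1)\<^sup>2) - 4 * S 1 * S 0 =
      bar b (N + 2) * AN' * BN' + (\<Sum>j\<in>P. \<kappa> j * bar b j * A' j * B' j)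
      + (if 1 \<in> P then 4 * b / X\<^sup>2 * (B' 1)\<^sup>2 else 0)"
    using weighted_pair_identity[OF P Xp X0, where h = W and a = b]
    unfolding S_def X1 bX kb AN'_def BN'_def A'_def B'_def by simp
  define M where "M = wsum P"
  \<comment> \<open>The \<open>a\<close>-relation is applied to complements: the weights are
    transported along \<open>C \<mapsto> P - C\<close>, and the moments change by
    \<open>wsum (P - I) = M - wsum I\<close>.\<close>
  define g where "g = (\<lambda>C. W (P - C))"
  have compl: "(\<Sum>C\<in>Pow P. g C * f C) = (\<Sum>I\<in>Pow P. W I * f (P - I))" for f :: "nat set \<Rightarrow> complex"
    using sum_Pow_compl[OF P(1), of "\<lambda>C. g C * f C"] by (simp add: g_def double_diff)
  have wc: "wsum (P - I) = M - wsum I" if "I \<in> Pow P" for I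
    using that P unfolding M_def wsum_def by (simp add: sum_diff finite_subset)
  have g0: "(\<Sum>C\<in>Pow P. g C * wsum C ^ 0) = S 0"
    unfolding compl S_def by simp
  have g1: "(\<Sum>C\<in>Pow P. g C * wsum C ^ 1) = M * S 0 - S 1"
    unfolding compl S_def sum_distrib_left sum_subtractf[symmetric]
    by (intro sum.cong) (auto simp: wc algebra_simps)
  have g2: "(\<Sum>C\<in>Pow P. g C * wsum C ^ 2) = M\<^sup>2 * S 0 - 2 * M * S 1 + S 2"
    unfolding compl S_def sum_distrib_left sum_subtractf[symmetric] sum.distrib[symmetric]
    by (intro sum.cong) (auto simp: wc algebra_simps power2_eq_square)
  have gB: "(\<Sum>D\<in>Pow (P - {j}). g (insert j D) * up D (of_nat j)) = B j" for j
  proof -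
    have e: "P - insert j (P - {j} - J) = J" if "J \<in> Pow (P - {j})" for J
      using that by auto
    have "(\<Sum>D\<in>Pow (P - {j}). g (insert j D) * up D (of_nat j)) =
       (\<Sum>J\<in>Pow (P - {j}). g (insert j (P - {j} - J)) * up (P - {j} - J) (of_nat j))"
      using P by (intro sum_Pow_compl[symmetric]) auto
    also have "\<dots> = B j" unfolding B_def g_def using e by (intro sum.cong) simp_all
    finally show ?thesis .
  qed
  have gB1: "(\<Sum>D\<in>Pow (P - {1}). g (insert 1 D) * up D 1) = B 1"
    using gB[of 1] by (simp only: of_nat_1)
  have "bar a (N + 2) * (S 0)\<^sup>2 + 4 * ((M\<^sup>2 * S 0 - 2 * M * S 1 + S 2) * S 0 - (M * S 0 - S 1)\<^sup>2)
      - 4 * (M * S 0 - S 1) * S 0 =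
      bar a (N + 2) * AN * BN + (\<Sum>j\<in>P. \<kappa> j * bar a j * A j * B j)
      + (if 1 \<in> P then 4 * a / X\<^sup>2 * (B 1)\<^sup>2 else 0)"
    using weighted_pair_identity[OF P Xp X0, where h = g and a = a]
    unfolding X1 bX kb g0 g1 g2 gB gB1 compl AN_def BN_def A_def by simp
  \<comment> \<open>Like a variance, \<open>S 2 * S 0 - (S 1)^2\<close> is invariant under this
    reflection; only the linear term changes.\<close>
  then have a_part: "bar a (N + 2) * (S 0)\<^sup>2 + 4 * (S 2 * S 0 - (S 1)\<^sup>2) - 4 * M * (S 0)\<^sup>2 + 4 * S 1 * S 0 =
      bar a (N + 2) * AN * BN + (\<Sum>j\<in>P. \<kappa> j * bar a j * A j * B j)
      + (if 1 \<in> P then 4 * a / X\<^sup>2 * (B 1)\<^sup>2 else 0)"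
    by (simp add: power2_eq_square algebra_simps)
  \<comment> \<open>The residue sums agree termwise: for \<open>j \<ge> 2\<close> by
    \<open>link_identity\<close>, and for \<open>j = 1\<close> because
    \<open>\<kappa> 1 = 0\<close>.\<close>
  have links: "w\<^sup>2 * (\<Sum>j\<in>P. \<kappa> j * bar b j * A' j * B' j) = z\<^sup>2 * (\<Sum>j\<in>P. \<kappa> j * bar a j * A j * B j)"
    unfolding sum_distrib_left
  proof (intro sum.cong refl)
    fix j assume j: "j \<in> P"
    show "w\<^sup>2 * (\<kappa> j * bar b j * A' j * B' j) = z\<^sup>2 * (\<kappa> j * bar a j * A j * B j)"
    proof (cases "j = 1")
      case True
      then show ?thesis by (simp add: \<kappa>_def)
    next
      case False
      then have "2 \<le> j" "j \<in> idx n m" using j P by (auto simp: P_def idx_iff)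
      from link_identity[OF \<alpha>0 \<beta>0 \<alpha> \<beta> this(2,1)]
      have "z\<^sup>2 * bar a j * A j * B j = w\<^sup>2 * bar b j * A' j * B' j"
        unfolding A_def A'_def B_def B'_def W P_def[symmetric] by simp
      then have "\<kappa> j * (w\<^sup>2 * bar b j * A' j * B' j) = \<kappa> j * (z\<^sup>2 * bar a j * A j * B j)"
        by (simp only:)
      then show ?thesis by (simp only: mult_ac)
    qed
  qed
  have low: "w\<^sup>2 * (if 1 \<in> P then 4 * b / X\<^sup>2 * (B' 1)\<^sup>2 else 0) - z\<^sup>2 * (if 1 \<in> P then 4 * a / X\<^sup>2 * (B 1)\<^sup>2 else 0)
    = 4 / X\<^sup>2 * a * b * (a - b) * z\<^sup>2 * w\<^sup>2 * (umemura 1 n m z w a b)\<^sup>2"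
  proof (cases "1 \<in> P")
    case True
    define Q where "Q = P - {1}"
    have Q: "finite Q" "1 \<notin> Q" "0 \<notin> Q" "P = insert 1 Q" using True P by (auto simp: Q_def)
    have n: "n \<ge> 1" using True by (cases n) (auto simp: P_def idx_iff)
    define Y s where "Y = up Q 1 * csum n \<alpha> \<beta> 1 Q" and "s = (\<Prod>k\<in>Q. sg 1 k)"
    have s: "s\<^sup>2 = 1" unfolding s_def power2_eq_square by (simp add: prod.distrib[symmetric])
    have "B' 1 = (\<Sum>I\<in>Pow Q. wt n \<alpha> \<beta> (insert 1 Q) (insert 1 I) * up I (of_nat 1))"
      "B 1 = (\<Sum>I\<in>Pow Q. wt n \<alpha> \<beta> (insert 1 Q) I * up (Q - I) (of_nat 1))"
      unfolding B_def B'_def W Q_def[symmetric] Q(4)[symmetric] by (rule refl)+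
    \<comment> \<open>Both collision sums are multiples of the same \<open>Y\<close>. Their squares
      carry \<open>(a * z)^2\<close> and \<open>(b * w)^2\<close>, whose weighted difference has the
      factor \<open>a * b * (a - b)\<close>.\<close>
    then have "B' 1 = \<alpha> 1 * s * Y" "B 1 = \<beta> 1 * Y"
      unfolding sum_up[OF Q(1-3)] sum_up_compl[OF Q(1-3)] using n
      by (simp_all add: Y_def s_def c_exp_singleton)
    moreover have "umemura 1 n m z w a b = s * Y"
      using umemura_1_eq[of n m z w a b] True by (simp add: Y_def s_def Q_def P_def \<alpha>_def \<beta>_def)
    moreover have "\<alpha> 1 = a * z" "\<beta> 1 = b * w" unfolding \<alpha>_def \<beta>_def par_1 by simp_all
    moreover have "w\<^sup>2 * (4 * b / X\<^sup>2 * (a * z * s * Y)\<^sup>2) - z\<^sup>2 * (4 * a / X\<^sup>2 * (b * w * Y)\<^sup>2) =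
        4 / X\<^sup>2 * a * b * (a - b) * z\<^sup>2 * w\<^sup>2 * (s * Y)\<^sup>2"
      unfolding power_mult_distrib s
      by (simp add: power2_eq_square algebra_simps diff_divide_distrib)
    ultimately show ?thesis using True by simp
  next
    case False
    then have "\<not> {1..1} \<subseteq> idx n m" by (auto simp: P_def)
    then have "{I. {1..1} \<subseteq> I \<and> I \<subseteq> idx n m} = {}" by blast
    then have "umemura 1 n m z w a b = 0" unfolding umemura_def by (simp only: sum.empty)
    then show ?thesis using False by simp
  qed
  define E where "E = 4 * (S 2 * S 0 - (S 1)\<^sup>2)"
  have "w\<^sup>2 * bar b (N + 2) * AN' * BN' - z\<^sup>2 * bar a (N + 2) * AN * BN =
    w\<^sup>2 * (bar b (N + 2) * (S 0)\<^sup>2 + E - 4 * S 1 * S 0)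
    - z\<^sup>2 * (bar a (N + 2) * (S 0)\<^sup>2 + E - 4 * M * (S 0)\<^sup>2 + 4 * S 1 * S 0)
    - 4 / X\<^sup>2 * a * b * (a - b) * z\<^sup>2 * w\<^sup>2 * (umemura 1 n m z w a b)\<^sup>2"
    unfolding E_def b_part a_part using links low by (simp add: algebra_simps)
  \<comment> \<open>The second-order part \<open>E\<close> enters with the coefficient
    \<open>w^2 - z^2\<close>, which is 1.\<close>
  also have "\<dots> = (- bar a (N + 2) * z\<^sup>2 + bar b (N + 2) * w\<^sup>2) * (S 0)\<^sup>2
    + ((w\<^sup>2 - z\<^sup>2) * E - 4 * (z\<^sup>2 + w\<^sup>2) * S 1 * S 0 + 4 * M * z\<^sup>2 * (S 0)\<^sup>2)
    - 4 / X\<^sup>2 * a * b * (a - b) * z\<^sup>2 * w\<^sup>2 * (umemura 1 n m z w a b)\<^sup>2"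
    by (simp add: algebra_simps)
  finally show ?thesis unfolding top zw E_def M_def X_def N_def by simp
qed

section \<open>Hirota derivatives\<close>

text \<open>Here \<open>(r - g) * (r + g) = 0\<close>. If \<open>r - g\<close> is nonzero somewhere,
  it is nonzero on an open set; there \<open>r + g\<close> vanishes, and by analytic continuation it
  vanishes on \<open>T\<close>.\<close>

lemma holomorphic_square_root_unique:
  assumes T: "open T" "connected T" and hol: "r holomorphic_on T" "g holomorphic_on T"
    and sq: "\<And>x. x \<in> T \<Longrightarrow> (r x)\<^sup>2 = (g x)\<^sup>2"
  shows "\<exists>\<epsilon>::complex. \<epsilon>\<^sup>2 = 1 \<and> (\<forall>x\<in>T. r x = \<epsilon> * g x)"
proof (cases "\<forall>x\<in>T. r x = g x")
  case True
  then show ?thesis by (intro exI[of _ 1]) simp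
next
  case False
  define V where "V = {x \<in> T. r x - g x \<noteq> 0}"
  have "continuous_on T (\<lambda>x. r x - g x)"
    using hol by (intro continuous_on_diff holomorphic_on_imp_continuous_on)
  then have "open (T \<inter> (\<lambda>x. r x - g x) -` (- {0}))"
    using T(1) by (intro continuous_open_preimage) auto
  moreover have "T \<inter> (\<lambda>x. r x - g x) -` (- {0}) = V" by (auto simp: V_def)
  ultimately have V: "open V" "V \<noteq> {}" "V \<subseteq> T" using False by (auto simp: V_def)
  have "r x + g x = 0" if "x \<in> T" for x
  proof (rule analytic_continuation_open[of V T "\<lambda>x. r x + g x" "\<lambda>_. 0"])
    fix y assume "y \<in> V"
    then have "(r y + g y) * (r y - g y) = 0" "r y - g y \<noteq> 0"
      using sq[of y] by (auto simp: V_def power2_eq_square algebra_simps)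
    then show "r y + g y = 0" by simp
  qed (use V T hol that in \<open>auto intro!: holomorphic_intros\<close>)
  then show ?thesis by (intro exI[of _ "- 1"]) (auto simp: eq_neg_iff_add_eq_0)
qed

text \<open>\<open>z * w\<close> times the derivative multiplies a monomial by
  \<open>\<sigma> / 2 * (p * w^2 + q * z^2)\<close>, which for \<open>p + q = M\<close> and
  \<open>w^2 = z^2 + 1\<close> is \<open>\<sigma> / 2 * (p + M * z^2)\<close>. Hence the moments of
  \<open>p\<close> suffice, and \<open>\<sigma>\<close> enters only through its square.\<close>

lemma hirota_D2_monomial_sum:
  fixes z w :: "complex \<Rightarrow> complex" and c :: "'i \<Rightarrow> complex" and p q :: "'i \<Rightarrow> nat" and \<sigma> :: complex and A :: "'i set"
  defines "f \<equiv> \<lambda>t. \<Sum>i\<in>A. c i * (z t ^ p i * w t ^ q i)"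
    and "S \<equiv> \<lambda>e t. \<Sum>i\<in>A. c i * (z t ^ p i * w t ^ q i) * of_nat (p i) ^ e"
  assumes T: "open T" "x \<in> T" and \<sigma>: "\<sigma>\<^sup>2 = 1"
    and dz: "\<And>t. t \<in> T \<Longrightarrow> (z has_field_derivative \<sigma> / 2 * w t) (at t)"
    and dw: "\<And>t. t \<in> T \<Longrightarrow> (w has_field_derivative \<sigma> / 2 * z t) (at t)"
    and zw: "(w x)\<^sup>2 - (z x)\<^sup>2 = 1"
    and M: "\<And>i. i \<in> A \<Longrightarrow> of_nat (p i) + of_nat (q i) = M"
  shows "8 * (z x)\<^sup>2 * (w x)\<^sup>2 * hirota_D2 f f x =
    4 * (S 2 x * S 0 x - (S 1 x)\<^sup>2) - 4 * ((z x)\<^sup>2 + (w x)\<^sup>2) * S 1 x * S 0 x + 4 * M * (z x)\<^sup>2 * (S 0 x)\<^sup>2"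
proof -
  define e where "e = (\<lambda>i t. z t ^ p i * w t ^ q i)"
  \<comment> \<open>Multiplying derivatives by \<open>z * w\<close> avoids the exponents \<open>p - 1\<close> and \<open>q - 1\<close>,
    which are truncated at 0.\<close>
  define E where "E = (\<lambda>i t. of_nat (p i) * z t ^ (p i - 1) * (\<sigma> / 2 * w t) * w t ^ q i
    + z t ^ p i * (of_nat (q i) * w t ^ (q i - 1) * (\<sigma> / 2 * z t)))"
  define L where "L = (\<lambda>i t. of_nat (p i) * (w t)\<^sup>2 + of_nat (q i) * (z t)\<^sup>2)"
  have de: "(e i has_field_derivative E i t) (at t)" if "t \<in> T" for i t
    unfolding e_def E_def
    by (rule derivative_eq_intros dz dw that refl)+ (simp add: mult_ac)
  have E: "z t * w t * E i t = \<sigma> / 2 * (L i t * e i t)" for i t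
  proof -
    have "of_nat k * (u * u ^ (k - 1)) = of_nat k * u ^ k" for k and u :: complex
      by (cases k) auto
    note zp = this[of "p i" "z t"] and wq = this[of "q i" "w t"]
    have "z t * w t * E i t =
        \<sigma> / 2 * ((w t)\<^sup>2 * (of_nat (p i) * (z t * z t ^ (p i - 1))) * w t ^ q i
          + (z t)\<^sup>2 * z t ^ p i * (of_nat (q i) * (w t * w t ^ (q i - 1))))"
      unfolding E_def by (simp add: power2_eq_square algebra_simps)
    then show ?thesis unfolding zp wq L_def e_def by (simp add: algebra_simps)
  qed
  have df: "(f has_field_derivative (\<Sum>i\<in>A. c i * E i t)) (at t)" if "t \<in> T" for t
    unfolding f_def using de[OF that] unfolding e_def
    by (intro DERIV_sum DERIV_cmult)
  have hol: "f holomorphic_on T"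
    using df by (auto simp: holomorphic_on_open[OF T(1)])
  define f1 f2 where "f1 = deriv f" and "f2 = deriv (deriv f) x"
  have f1: "z t * w t * f1 t = \<sigma> / 2 * (\<Sum>i\<in>A. c i * (L i t * e i t))" if "t \<in> T" for t
  proof -
    have "f1 t = (\<Sum>i\<in>A. c i * E i t)" unfolding f1_def using df[OF that] by (rule DERIV_imp_deriv)
    then have "z t * w t * f1 t = (\<Sum>i\<in>A. c i * (z t * w t * E i t))"
      by (simp add: sum_distrib_left mult_ac)
    then show ?thesis unfolding E by (simp add: sum_distrib_left mult_ac)
  qed
  have df1: "(f1 has_field_derivative f2) (at x)"
    unfolding f1_def f2_def using holomorphic_deriv[OF hol T(1)] T holomorphic_derivI by blast
  define Z W where "Z = z x" and "W = w x"
  \<comment> \<open>The function \<open>z * w * f1\<close> is differentiated in two ways, as a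
    product and through the sum in fact \<open>f1\<close>. Comparing them determines
    \<open>f2\<close> multiplied by \<open>z * w\<close>, which may vanish at
    \<open>x\<close>.\<close>
  have "((\<lambda>t. z t * w t * f1 t) has_field_derivative
      \<sigma> / 2 * (W\<^sup>2 + Z\<^sup>2) * f1 x + Z * W * f2) (at x)"
    by (rule derivative_eq_intros dz dw df1 T refl)+ (simp add: Z_def W_def power2_eq_square algebra_simps)
  then have "((\<lambda>t. \<sigma> / 2 * (\<Sum>i\<in>A. c i * (L i t * e i t))) has_field_derivative
      \<sigma> / 2 * (W\<^sup>2 + Z\<^sup>2) * f1 x + Z * W * f2) (at x)"
    by (rule has_field_derivative_transform_within_open[OF _ T]) (rule f1)
  moreover have "((\<lambda>t. \<sigma> / 2 * (\<Sum>i\<in>A. c i * (L i t * e i t))) has_field_derivative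
      \<sigma> / 2 * (\<Sum>i\<in>A. c i * (\<sigma> * M * Z * W * e i x + L i x * E i x))) (at x)"
  proof (intro DERIV_cmult DERIV_sum)
    fix i assume i: "i \<in> A"
    have "(L i has_field_derivative \<sigma> * (of_nat (p i) + of_nat (q i)) * Z * W) (at x)"
      unfolding L_def
      by (rule derivative_eq_intros dz dw T refl)+ (simp add: Z_def W_def algebra_simps)
    then have "(L i has_field_derivative \<sigma> * M * Z * W) (at x)" using M[OF i] by simp
    from DERIV_mult[OF this de[OF T(2)], of i]
    show "((\<lambda>t. L i t * e i t) has_field_derivative \<sigma> * M * Z * W * e i x + L i x * E i x) (at x)"
      by (simp add: mult_ac)
  qed
  ultimately have "\<sigma> / 2 * (W\<^sup>2 + Z\<^sup>2) * f1 x + Z * W * f2 =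
      \<sigma> / 2 * (\<Sum>i\<in>A. c i * (\<sigma> * M * Z * W * e i x + L i x * E i x))"
    by (rule DERIV_unique)
  then have "Z * W * (\<sigma> / 2 * (W\<^sup>2 + Z\<^sup>2) * f1 x + Z * W * f2) =
      \<sigma> / 2 * (\<Sum>i\<in>A. c i * (\<sigma> * M * Z\<^sup>2 * W\<^sup>2 * e i x + L i x * (Z * W * E i x)))"
    by (simp add: sum_distrib_left power2_eq_square algebra_simps)
  also have "\<dots> = (\<Sum>i\<in>A. c i * (\<sigma>\<^sup>2 / 2 * M * Z\<^sup>2 * W\<^sup>2 * e i x + \<sigma>\<^sup>2 / 4 * ((L i x)\<^sup>2 * e i x)))"
    unfolding sum_distrib_left Z_def W_def E
    by (intro sum.cong refl) (simp add: power2_eq_square field_simps)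
  also have "\<dots> = (\<Sum>i\<in>A. c i * (1 / 2 * M * Z\<^sup>2 * W\<^sup>2 * e i x + 1 / 4 * ((L i x)\<^sup>2 * e i x)))"
    unfolding \<sigma> ..
  finally have f2: "Z\<^sup>2 * W\<^sup>2 * f2 = (\<Sum>i\<in>A. c i * (1 / 2 * M * Z\<^sup>2 * W\<^sup>2 * e i x + 1 / 4 * ((L i x)\<^sup>2 * e i x)))
      - \<sigma> / 2 * (W\<^sup>2 + Z\<^sup>2) * (Z * W * f1 x)"
    by (simp add: power2_eq_square algebra_simps)
  define S0 S1 S2 where "S0 = S 0 x" and "S1 = S 1 x" and "S2 = S 2 x"
  have W2: "W\<^sup>2 = Z\<^sup>2 + 1" using zw by (simp add: Z_def W_def algebra_simps)
  have L: "L i x = of_nat (p i) + M * Z\<^sup>2" if "i \<in> A" for i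
    using M[OF that, symmetric] W2 unfolding L_def Z_def W_def by (simp add: algebra_simps)
  have "(\<Sum>i\<in>A. c i * (L i x * e i x)) = S1 + M * Z\<^sup>2 * S0"
    unfolding S1_def S0_def S_def sum_distrib_left sum.distrib[symmetric]
    by (intro sum.cong refl) (simp add: L e_def algebra_simps)
  then have g1: "Z * W * f1 x = \<sigma> / 2 * (S1 + M * Z\<^sup>2 * S0)"
    using f1[OF T(2)] by (simp add: Z_def W_def)
  have "(\<Sum>i\<in>A. c i * (1 / 2 * M * Z\<^sup>2 * W\<^sup>2 * e i x + 1 / 4 * ((L i x)\<^sup>2 * e i x))) =
    1 / 2 * M * Z\<^sup>2 * W\<^sup>2 * S0 + 1 / 4 * (S2 + 2 * M * Z\<^sup>2 * S1 + M\<^sup>2 * Z^4 * S0)"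
    unfolding S1_def S0_def S2_def S_def sum_distrib_left sum.distrib[symmetric]
    by (intro sum.cong refl) (simp add: L e_def algebra_simps power2_eq_square power4_eq_xxxx)
  then have g2: "Z\<^sup>2 * W\<^sup>2 * f2 = 1 / 2 * M * Z\<^sup>2 * W\<^sup>2 * S0
      + 1 / 4 * (S2 + 2 * M * Z\<^sup>2 * S1 + M\<^sup>2 * Z^4 * S0) - \<sigma>\<^sup>2 / 4 * (W\<^sup>2 + Z\<^sup>2) * (S1 + M * Z\<^sup>2 * S0)"
    unfolding f2 g1 by (simp add: power2_eq_square)
  have fx: "f x = S0" by (simp add: f_def S0_def S_def)
  have h: "hirota_D2 f f x = 2 * (f2 * f x - (f1 x)\<^sup>2)"
    by (simp add: hirota_D2_def f1_def f2_def numeral_2_eq_2 power2_eq_square algebra_simps)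
  have "8 * Z\<^sup>2 * W\<^sup>2 * hirota_D2 f f x = 16 * ((Z\<^sup>2 * W\<^sup>2 * f2) * S0 - (Z * W * f1 x)\<^sup>2)"
    unfolding h fx by (simp add: power_mult_distrib algebra_simps)
  also have "\<dots> = 4 * (S2 * S0 - S1\<^sup>2) - 4 * (Z\<^sup>2 + W\<^sup>2) * S1 * S0 + 4 * M * Z\<^sup>2 * S0\<^sup>2"
    unfolding g2 g1 unfolding power_mult_distrib power_divide \<sigma> W2
    by (simp add: power2_eq_square power4_eq_xxxx field_simps)
  finally show ?thesis unfolding Z_def W_def S0_def S1_def S2_def by simp
qed

section \<open>The identity for arbitrary holomorphic branches of the square roots\<close>

theorem theorem4p1:
  fixes n m :: nat and a b :: complex and S :: "complex set"
    and r s z w :: "complex \<Rightarrow> complex"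
    and U :: "nat \<Rightarrow> complex \<Rightarrow> complex" and U1 :: "nat \<Rightarrow> complex \<Rightarrow> complex"
  assumes "m \<ge> 1"
    and "open S"
    and "sqrt_branch_on S (\<lambda>x. exp x + exp (- x) - 2) r"
    and "sqrt_branch_on S (\<lambda>x. exp x + exp (- x) + 2) s"
  defines "z \<equiv> \<lambda>x. 1 / 2 * r x"
    and "w \<equiv> \<lambda>x. 1 / 2 * s x"
    and "U \<equiv> \<lambda>l x. umemura 0 n l (z x) (w x) a b"
    and "U1 \<equiv> \<lambda>l x. umemura 1 n l (z x) (w x) a b"
  shows "\<forall>x\<in>S.
    U (m - 1) x * U (m + 1) x =
      (- bar a (n + 2 * m + 2) * (z x)\<^sup>2 + bar b (n + 2 * m + 2) * (w x)\<^sup>2) * (U m x)\<^sup>2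
      + 8 * (z x)\<^sup>2 * (w x)\<^sup>2 * hirota_D2 (U m) (U m) x
      - 4 / (of_nat (n + 2 * m + 1))\<^sup>2 * a * b * (a - b) * (z x)\<^sup>2 * (w x)\<^sup>2 * (U1 m x)\<^sup>2"
proof
  fix x assume x: "x \<in> S"
  \<comment> \<open>A ball, because the sign between a branch and a fixed entire root is constant
    only on connected sets, and \<open>S\<close> need not be connected.\<close>
  then obtain d where d: "d > 0" "ball x d \<subseteq> S" using assms(2) open_contains_ball by blast
  define T where "T = ball x d"
  have T: "open T" "connected T" "x \<in> T" "T \<subseteq> S" using d by (auto simp: T_def)
  have r: "r holomorphic_on T" "\<And>t. t \<in> T \<Longrightarrow> (r t)\<^sup>2 = exp t + exp (- t) - 2"
    and s: "s holomorphic_on T" "\<And>t. t \<in> T \<Longrightarrow> (s t)\<^sup>2 = exp t + exp (- t) + 2"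
    using assms(3,4) T(4) unfolding sqrt_branch_on_def by (auto intro: holomorphic_on_subset)
  have half: "exp (t / 2) * exp (t / 2) = exp t" "exp (- (t / 2)) * exp (- (t / 2)) = exp (- t)"
    "exp (t / 2) * exp (- (t / 2)) = 1" for t :: complex
    by (simp_all add: exp_add[symmetric] field_simps)
  \<comment> \<open>The radicands are the squares of \<open>2 * sinh (t / 2)\<close> and
    \<open>2 * cosh (t / 2)\<close>, so \<open>r\<close> and \<open>s\<close> equal these up to
    signs \<open>\<epsilon>\<close> and \<open>\<delta>\<close>.\<close>
  obtain \<epsilon> where \<epsilon>: "\<epsilon>\<^sup>2 = 1" "\<And>t. t \<in> T \<Longrightarrow> r t = \<epsilon> * (exp (t / 2) - exp (- (t / 2)))"
  proof -
    have "\<exists>\<epsilon>::complex. \<epsilon>\<^sup>2 = 1 \<and> (\<forall>t\<in>T. r t = \<epsilon> * (exp (t / 2) - exp (- (t / 2))))"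
    proof (rule holomorphic_square_root_unique[OF T(1,2) r(1)])
      show "(r t)\<^sup>2 = (exp (t / 2) - exp (- (t / 2)))\<^sup>2" if "t \<in> T" for t
        unfolding r(2)[OF that] half[symmetric, of t] using half(3)[of t]
        by (simp add: power2_eq_square algebra_simps)
    qed (intro holomorphic_intros; simp)
    then show ?thesis using that by blast
  qed
  obtain \<delta> where \<delta>: "\<delta>\<^sup>2 = 1" "\<And>t. t \<in> T \<Longrightarrow> s t = \<delta> * (exp (t / 2) + exp (- (t / 2)))"
  proof -
    have "\<exists>\<epsilon>::complex. \<epsilon>\<^sup>2 = 1 \<and> (\<forall>t\<in>T. s t = \<epsilon> * (exp (t / 2) + exp (- (t / 2))))"
    proof (rule holomorphic_square_root_unique[OF T(1,2) s(1)])
      show "(s t)\<^sup>2 = (exp (t / 2) + exp (- (t / 2)))\<^sup>2" if "t \<in> T" for t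
        unfolding s(2)[OF that] half[symmetric, of t] using half(3)[of t]
        by (simp add: power2_eq_square algebra_simps)
    qed (intro holomorphic_intros; simp)
    then show ?thesis using that by blast
  qed
  define \<sigma> where "\<sigma> = \<epsilon> * \<delta>"
  have \<sigma>: "\<sigma>\<^sup>2 = 1" using \<epsilon> \<delta> by (simp add: \<sigma>_def power_mult_distrib)
  have dz: "(z has_field_derivative \<sigma> / 2 * w t) (at t)" if t: "t \<in> T" for t
  proof -
    \<comment> \<open>In the inserted \<open>\<delta>^2 = 1\<close>, one \<open>\<delta>\<close>
      turns the sum of exponentials into \<open>s t\<close> and the other completes
      \<open>\<sigma>\<close>.\<close>
    have "((\<lambda>t. 1 / 2 * (\<epsilon> * (exp (t / 2) - exp (- (t / 2))))) has_field_derivative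
        \<epsilon> * \<delta>\<^sup>2 / 4 * (exp (t / 2) + exp (- (t / 2)))) (at t)"
      unfolding \<delta>(1) by (auto intro!: derivative_eq_intros simp: field_simps)
    then have "((\<lambda>t. 1 / 2 * (\<epsilon> * (exp (t / 2) - exp (- (t / 2))))) has_field_derivative \<sigma> / 2 * w t) (at t)"
      by (simp add: \<delta>(2)[OF t] \<sigma>_def w_def power2_eq_square mult_ac)
    then show ?thesis
      by (rule has_field_derivative_transform_within_open[OF _ T(1) t]) (simp add: z_def \<epsilon>)
  qed
  have dw: "(w has_field_derivative \<sigma> / 2 * z t) (at t)" if t: "t \<in> T" for t
  proof -
    have "((\<lambda>t. 1 / 2 * (\<delta> * (exp (t / 2) + exp (- (t / 2))))) has_field_derivative
        \<delta> * \<epsilon>\<^sup>2 / 4 * (exp (t / 2) - exp (- (t / 2)))) (at t)"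
      unfolding \<epsilon>(1) by (auto intro!: derivative_eq_intros simp: field_simps)
    then have "((\<lambda>t. 1 / 2 * (\<delta> * (exp (t / 2) + exp (- (t / 2))))) has_field_derivative \<sigma> / 2 * z t) (at t)"
      by (simp add: \<epsilon>(2)[OF t] \<sigma>_def z_def power2_eq_square mult_ac)
    then show ?thesis
      by (rule has_field_derivative_transform_within_open[OF _ T(1) t]) (simp add: w_def \<delta>)
  qed
  have zw: "(w x)\<^sup>2 - (z x)\<^sup>2 = 1"
    unfolding z_def w_def power_mult_distrib r(2)[OF T(3)] s(2)[OF T(3)] by (simp add: field_simps)
  define P where "P = idx n m"
  define c where "c = (\<lambda>I. of_real (d_coeff n m I) * (- 1) ^ c_exp n I * ((\<Prod>i\<in>I. par a i) * (\<Prod>i\<in>P - I. par b i)))"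
  define p q :: "nat set \<Rightarrow> nat" where "p = (\<lambda>I. \<Sum>i\<in>I. i)" and "q = (\<lambda>I. \<Sum>i\<in>P - I. i)"
  have wt: "wt n (\<lambda>i. par a i * z t ^ i) (\<lambda>i. par b i * w t ^ i) P I = c I * (z t ^ p I * w t ^ q I)" for t I
    by (simp add: wt_def c_def d_coeff_eq P_def p_def q_def power_sum prod.distrib mult_ac)
  have Ut: "U m t = (\<Sum>I\<in>Pow P. c I * (z t ^ p I * w t ^ q I))" for t
    unfolding U_def umemura_0_eq P_def[symmetric] wt ..
  have M: "(of_nat (p I) :: complex) + of_nat (q I) = of_nat (p P)" if "I \<in> Pow P" for I
  proof -
    have "finite P" "I \<subseteq> P" using that by (auto simp: P_def)
    then have "p I + q I = p P" unfolding p_def q_def by (metis add.commute sum.subset_diff)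
    then show ?thesis unfolding of_nat_add[symmetric] by simp
  qed
  have wp: "wsum I = of_nat (p I)" for I by (simp add: wsum_def p_def)
  have Um: "U m = (\<lambda>t. \<Sum>I\<in>Pow P. c I * (z t ^ p I * w t ^ q I))" using Ut by (rule ext)
  have hir: "8 * (z x)\<^sup>2 * (w x)\<^sup>2 * hirota_D2 (U m) (U m) x =
    4 * ((\<Sum>I\<in>Pow P. c I * (z x ^ p I * w x ^ q I) * of_nat (p I) ^ 2) * (\<Sum>I\<in>Pow P. c I * (z x ^ p I * w x ^ q I) * of_nat (p I) ^ 0)
        - (\<Sum>I\<in>Pow P. c I * (z x ^ p I * w x ^ q I) * of_nat (p I) ^ 1)\<^sup>2)
    - 4 * ((z x)\<^sup>2 + (w x)\<^sup>2) * (\<Sum>I\<in>Pow P. c I * (z x ^ p I * w x ^ q I) * of_nat (p I) ^ 1)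
        * (\<Sum>I\<in>Pow P. c I * (z x ^ p I * w x ^ q I) * of_nat (p I) ^ 0)
    + 4 * of_nat (p P) * (z x)\<^sup>2 * (\<Sum>I\<in>Pow P. c I * (z x ^ p I * w x ^ q I) * of_nat (p I) ^ 0)\<^sup>2"
    unfolding Um by (rule hirota_D2_monomial_sum[OF T(1,3) \<sigma> dz dw zw M])
  have U0: "(\<Sum>I\<in>Pow P. c I * (z x ^ p I * w x ^ q I) * of_nat (p I) ^ 0) = U m x"
    by (simp add: Ut)
  \<comment> \<open>Read from right to left, \<open>hir\<close> replaces the bracket of moments by
    the Hirota term.\<close>
  from umemura_algebraic_identity[OF assms(1) zw, of n a b, folded P_def, unfolded wt wp hir[symmetric]]
  show "U (m - 1) x * U (m + 1) x =
      (- bar a (n + 2 * m + 2) * (z x)\<^sup>2 + bar b (n + 2 * m + 2) * (w x)\<^sup>2) * (U m x)\<^sup>2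
      + 8 * (z x)\<^sup>2 * (w x)\<^sup>2 * hirota_D2 (U m) (U m) x
      - 4 / (of_nat (n + 2 * m + 1))\<^sup>2 * a * b * (a - b) * (z x)\<^sup>2 * (w x)\<^sup>2 * (U1 m x)\<^sup>2"
    unfolding U0 by (simp only: U_def U1_def)
qed

end
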